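(* Let $d\ge1$, $1<p\le q<\infty$, let $\mathbb X=\mathfrak f_{p,q}(\mathscr R_d)$ and let $\mathcal D$ be its canonical basis. Let $\tau\in(0,1]$ and consider the Weak Chebyshev Greedy Algorithm with weakness parameter $\tau$. Suppose that $\psi:\mathbb N\to\mathbb N$ and $C>0$ are such that $$\big\|\mathbf x-\mathscr G_{\psi(N)}(\mathbf x)\big\|\le C\,\sigma_N(\mathbf x)\qquad\text{for all }N\ge1,\ \mathbf x\in\mathfrak f_{p,q}(\mathscr R_d).$$ Then there is $c'>0$ such that $$\psi(N)\ge c'\,(1+\log N)^{p'(d-1)(\frac1p-\frac1q)}\,N\qquad\text{for all }N\ge1.$$
   Context: Scalars are $\mathbb K=\mathbb R$ or $\mathbb C$; $p'=p/(p-1)$. $\mathscr R_d$ is the set of all dyadic rectangles $I=I_1\times\dots\times I_d\subset[0,1]^d$ with $I_i=2^{-j_i}(k_i+[0,1))$, $j_i,k_i\in\{0,1,2,\dots\}$, $0\le k_i<2^{j_i}$. $\mathbf 1_{I,p}=|I|^{-1/p}\mathbf 1_I$. The space $\mathfrak f_{p,q}(\mathscr R_d)$ consists of all scalar sequences $\mathbf x=(x_I)_{I\in\mathscr R_d}$ with finite norm $$\|\mathbf x\|=\Big\|\Big(\sum_{I\in\mathscr R_d}|x_I\mathbf 1_{I,p}|^q\Big)^{1/q}\Big\|_{L^p([0,1]^d)},$$ and $\{\mathbf e_I\}_{I\in\mathscr R_d}$ is its canonical basis. For a dictionary $\mathcal D$ (unit vectors with dense span), $\Sigma_N$ is the set of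 linear combinations of at most $N$ elements of $\mathcal D$, $\sigma_N(f)=\inf_{a\in\Sigma_N}\|f-a\|$. For $f\neq0$, $F_f\in\mathbb X^*$ is the norming functional: $\|F_f\|_{\mathbb X^*}=1$, $F_f(f)=\|f\|$. Square brackets denote linear span. Weak Chebyshev Greedy Algorithm (WCGA) with parameter $\tau\in(0,1]$: given $f\neq0$ put $f_0=f$. At step $n+1$ choose any $\varphi_{i_{n+1}}\in\mathcal D$ with $|F_{f_n}(\varphi_{i_{n+1}})|\ge\tau\sup_{\varphi\in\mathcal D}|F_{f_n}(\varphi)|$; let $\mathscr G_{n+1}(f)$ be any element of $[\varphi_{i_1},\dots,\varphi_{i_{n+1}}]$ with $\|f-\mathscr G_{n+1}(f)\|=\mathrm{dist}(f,[\varphi_{i_1},\dots,\varphi_{i_{n+1}}])$; put $f_{n+1}=f-\mathscr G_{n+1}(f)$. Iterate indefinitely, or until the remainder is $0$ (in which case the later remainders are also taken to be $0$). The hypothesis on $\|\mathbf x-\mathscr G_{\psi(N)}(\mathbf x)\|$ is understood to hold for every admissible run of the algorithm. *)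

theory Defs
  imports "HOL-Analysis.Analysis" "HOL-Library.Function_Algebras"
begin

text \<open>
  The scalar field is a type of class \<^class>\<open>real_normed_field\<close>. Its norm is
  multiplicative, so by the Gelfand--Mazur theorem its instances are exactly the real and
  the complex numbers, up to isometric isomorphism.

  A normed space here is a set \<open>V\<close> of scalar families \<open>'i \<Rightarrow> 'k\<close> with a norm \<open>nrm\<close>;
  \<open>nrm\<close> is meaningful on \<open>V\<close> only. Vector addition is pointwise.
\<close>

definition scale_fun :: "'k::field \<Rightarrow> ('i \<Rightarrow> 'k) \<Rightarrow> ('i \<Rightarrow> 'k)" where
  "scale_fun c x = (\<lambda>i. c * x i)"

global_interpretation fun_vs: vector_space "scale_fun :: 'k::field \<Rightarrow> ('i \<Rightarrow> 'k) \<Rightarrow> ('i \<Rightarrow> 'k)"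
  by unfold_locales (auto simp: scale_fun_def fun_eq_iff algebra_simps)

definition dist_to :: "(('i \<Rightarrow> 'k::field) \<Rightarrow> real) \<Rightarrow> ('i \<Rightarrow> 'k) \<Rightarrow> ('i \<Rightarrow> 'k) set \<Rightarrow> real" where
  "dist_to nrm f A = (INF a\<in>A. nrm (f - a))"

definition Sigma_N :: "('i \<Rightarrow> 'k::field) set \<Rightarrow> nat \<Rightarrow> ('i \<Rightarrow> 'k) set" where
  "Sigma_N D N = (\<Union>A\<in>{A. A \<subseteq> D \<and> finite A \<and> card A \<le> N}. fun_vs.span A)"

definition sigma_N ::
  "(('i \<Rightarrow> 'k::field) \<Rightarrow> real) \<Rightarrow> ('i \<Rightarrow> 'k) set \<Rightarrow> nat \<Rightarrow> ('i \<Rightarrow> 'k) \<Rightarrow> real" where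
  "sigma_N nrm D N f = dist_to nrm f (Sigma_N D N)"

text \<open>A functional is a total function on families of which only the values on \<open>V\<close> matter.\<close>

definition bounded_functional_on ::
  "('i \<Rightarrow> 'k::real_normed_field) set \<Rightarrow> (('i \<Rightarrow> 'k) \<Rightarrow> real) \<Rightarrow> (('i \<Rightarrow> 'k) \<Rightarrow> 'k) \<Rightarrow> bool" where
  "bounded_functional_on V nrm F \<longleftrightarrow>
     (\<forall>x\<in>V. \<forall>y\<in>V. F (x + y) = F x + F y) \<and>
     (\<forall>c. \<forall>x\<in>V. F (scale_fun c x) = c * F x) \<and>
     (\<exists>B. \<forall>x\<in>V. norm (F x) \<le> B * nrm x)"

definition dual_norm ::
  "('i \<Rightarrow> 'k::real_normed_field) set \<Rightarrow> (('i \<Rightarrow> 'k) \<Rightarrow> real) \<Rightarrow> (('i \<Rightarrow> 'k) \<Rightarrow> 'k) \<Rightarrow> real" where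
  "dual_norm V nrm F = (SUP x\<in>{x\<in>V. nrm x \<le> 1}. norm (F x))"

definition norming_functional ::
  "('i \<Rightarrow> 'k::real_normed_field) set \<Rightarrow> (('i \<Rightarrow> 'k) \<Rightarrow> real) \<Rightarrow> ('i \<Rightarrow> 'k) \<Rightarrow> (('i \<Rightarrow> 'k) \<Rightarrow> 'k) \<Rightarrow> bool"
  where
  "norming_functional V nrm f F \<longleftrightarrow>
     bounded_functional_on V nrm F \<and> dual_norm V nrm F = 1 \<and> F f = of_real (nrm f)"

text \<open>
  An admissible run on input \<open>f\<close>: \<open>\<phi> n\<close> is the element chosen at step \<open>n \<ge> 1\<close> (\<open>\<phi> 0\<close> is not
  used), \<open>G n\<close> the approximant after \<open>n\<close> steps, and \<open>f - G n\<close> the remainder. Once the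
  remainder vanishes, the approximant no longer changes.
\<close>

definition wcga_run ::
  "('i \<Rightarrow> 'k::real_normed_field) set \<Rightarrow> (('i \<Rightarrow> 'k) \<Rightarrow> real) \<Rightarrow> ('i \<Rightarrow> 'k) set \<Rightarrow> real \<Rightarrow>
   ('i \<Rightarrow> 'k) \<Rightarrow> (nat \<Rightarrow> 'i \<Rightarrow> 'k) \<Rightarrow> (nat \<Rightarrow> 'i \<Rightarrow> 'k) \<Rightarrow> bool" where
  "wcga_run V nrm D \<tau> f \<phi> G \<longleftrightarrow>
     G 0 = 0 \<and>
     (\<forall>n. if f - G n = 0 then G (Suc n) = G n
          else \<phi> (Suc n) \<in> D \<and>
               (\<exists>F. norming_functional V nrm (f - G n) F \<and>
                    norm (F (\<phi> (Suc n))) \<ge> \<tau> * (SUP g\<in>D. norm (F g))) \<and>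
               G (Suc n) \<in> fun_vs.span (\<phi> ` {1..Suc n}) \<and>
               nrm (f - G (Suc n)) = dist_to nrm f (fun_vs.span (\<phi> ` {1..Suc n})))"

text \<open>The dimension \<open>d\<close> is \<open>CARD('d)\<close>.\<close>

definition dyadic_rects :: "(real ^ 'd) set set" where
  "dyadic_rects = {I. \<exists>j k :: 'd \<Rightarrow> nat. (\<forall>i. k i < 2 ^ j i) \<and>
     I = {t. \<forall>i. real (k i) / 2 ^ j i \<le> t $ i \<and> t $ i < (real (k i) + 1) / 2 ^ j i}}"

definition normalized_indicator :: "real \<Rightarrow> (real ^ 'd) set \<Rightarrow> real ^ 'd \<Rightarrow> real" where
  "normalized_indicator p I t = measure lborel I powr (- 1 / p) * indicator I t"

text \<open>Powers of extended nonnegative reals, for exponents \<open>r > 0\<close> only.\<close>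

definition ennreal_powr :: "ennreal \<Rightarrow> real \<Rightarrow> ennreal" where
  "ennreal_powr a r = (if a = \<infinity> then \<infinity> else ennreal (enn2real a powr r))"

definition f_enorm :: "real \<Rightarrow> real \<Rightarrow> ((real ^ 'd) set \<Rightarrow> 'k::real_normed_field) \<Rightarrow> ennreal" where
  "f_enorm p q x =
     ennreal_powr
       (\<integral>\<^sup>+ t \<in> cbox 0 1.
          ennreal_powr
            (ennreal_powr
              (\<Sum>\<^sub>\<infinity>I\<in>dyadic_rects.
                 ennreal (norm (x I * of_real (normalized_indicator p I t)) powr q))
              (1 / q))
            p
        \<partial>lborel)
       (1 / p)"

definition f_norm :: "real \<Rightarrow> real \<Rightarrow> ((real ^ 'd) set \<Rightarrow> 'k::real_normed_field) \<Rightarrow> real" where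
  "f_norm p q x = enn2real (f_enorm p q x)"

text \<open>Families indexed by \<open>dyadic_rects\<close> are extended by zero to all subsets of the ambient space.\<close>

definition f_space :: "real \<Rightarrow> real \<Rightarrow> ((real ^ 'd) set \<Rightarrow> 'k::real_normed_field) set" where
  "f_space p q = {x. (\<forall>I. I \<notin> dyadic_rects \<longrightarrow> x I = 0) \<and> f_enorm p q x < \<infinity>}"

definition unit_seq :: "(real ^ 'd) set \<Rightarrow> (real ^ 'd) set \<Rightarrow> 'k::real_normed_field" where
  "unit_seq I = (\<lambda>J. if J = I then 1 else 0)"

definition canonical_basis :: "((real ^ 'd) set \<Rightarrow> 'k::real_normed_field) set" where
  "canonical_basis = unit_seq ` dyadic_rects"

end

theory Submission
  imports Defs
begin

text \<open>
  Let \<open>B\<close> be about \<open>N\<close> dyadic rectangles of equal volume that cover every point of half of the cube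
  \<open>K\<close> times, where \<open>K\<close> is of order \<open>(1 + ln N) ^ (d - 1)\<close>, let \<open>A\<close> be \<open>\<psi> N\<close> disjoint dyadic
  rectangles in the other half, and put \<open>x = a 1_A + 1_B\<close>. The overlap makes the norming functional
  of \<open>x\<close> small on \<open>B\<close>: it is proportional to \<open>a powr (p - 1)\<close> on \<open>A\<close> and at most
  \<open>K powr (p / q - 1)\<close> on \<open>B\<close>, also after some elements of \<open>A\<close> have been removed. With \<open>a\<close> chosen
  to make the two values equal, the algorithm may spend its first \<open>\<psi> N\<close> steps on \<open>A\<close>, and is left
  with \<open>1_B\<close>, although \<open>a 1_A\<close> is the remainder of an \<open>N\<close>-term approximation. Comparing the norms
  of \<open>1_B\<close> and \<open>a 1_A\<close> gives the bound on \<open>\<psi> N\<close>.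
\<close>

section \<open>Dyadic rectangles\<close>

definition dyadic_rect :: "('d \<Rightarrow> nat) \<Rightarrow> ('d \<Rightarrow> nat) \<Rightarrow> (real ^ 'd) set" where
  "dyadic_rect j k =
     {t. \<forall>i. real (k i) / 2 ^ j i \<le> t $ i \<and> t $ i < (real (k i) + 1) / 2 ^ j i}"

lemma dyadic_rectsE:
  assumes "I \<in> dyadic_rects"
  obtains j k where "\<And>i. k i < 2 ^ j i" "I = dyadic_rect j k"
  using assms unfolding dyadic_rects_def dyadic_rect_def by blast

lemma dyadic_rect_in_dyadic_rects: "(\<And>i. k i < 2 ^ j i) \<Longrightarrow> dyadic_rect j k \<in> dyadic_rects"
  unfolding dyadic_rects_def dyadic_rect_def by blast

lemma dyadic_rect_borel [measurable]: "dyadic_rect j k \<in> sets borel"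
  unfolding dyadic_rect_def by measurable

text \<open>The half-open rectangle lies between the open and the closed box with the same corners,
  and these two have equal measure.\<close>

lemma measure_dyadic_rect:
  fixes j k :: "'d::finite \<Rightarrow> nat"
  shows "measure lborel (dyadic_rect j k) = 1 / 2 ^ (\<Sum>i\<in>UNIV. j i)"
    and "emeasure lborel (dyadic_rect j k) = ennreal (1 / 2 ^ (\<Sum>i\<in>UNIV. j i))"
proof -
  define a b :: "real ^ 'd" where "a = (\<chi> i. real (k i) / 2 ^ j i)"
    and "b = (\<chi> i. (real (k i) + 1) / 2 ^ j i)"
  have le: "a \<bullet> c \<le> b \<bullet> c" if "c \<in> Basis" for c
    using that by (auto simp: Basis_vec_def a_def b_def inner_axis divide_right_mono)
  have sub: "box a b \<subseteq> dyadic_rect j k" "dyadic_rect j k \<subseteq> cbox a b"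
    unfolding dyadic_rect_def a_def b_def by (auto simp: mem_box_cart less_imp_le)
  have "a \<in> cbox a b"
    by (auto simp: mem_box_cart a_def b_def divide_right_mono)
  then have "measure lborel (cbox a b) = (\<Prod>i\<in>UNIV. b $ i - a $ i)"
    by (intro content_cbox_cart) auto
  also have "\<dots> = (\<Prod>i\<in>UNIV. 1 / 2 ^ j i)"
    by (auto simp: a_def b_def diff_divide_distrib[symmetric])
  also have "\<dots> = 1 / 2 ^ (\<Sum>i\<in>UNIV. j i)"
    by (simp add: prod_dividef power_sum)
  finally have m: "emeasure lborel (cbox a b) = ennreal (1 / 2 ^ (\<Sum>i\<in>UNIV. j i))"
    by (metis emeasure_eq_ennreal_measure emeasure_lborel_cbox_finite less_top_ennreal infinity_ennreal_def less_irrefl)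
  have "emeasure lborel (box a b) = emeasure lborel (cbox a b)"
    using le by (simp add: emeasure_lborel_box_eq emeasure_lborel_cbox_eq)
  then show e: "emeasure lborel (dyadic_rect j k) = ennreal (1 / 2 ^ (\<Sum>i\<in>UNIV. j i))"
    using emeasure_mono[OF sub(1), of lborel] emeasure_mono[OF sub(2), of lborel] m
    by simp
  show "measure lborel (dyadic_rect j k) = 1 / 2 ^ (\<Sum>i\<in>UNIV. j i)"
    by (simp add: measure_def e)
qed

lemma dyadic_rect_corner: "(\<chi> i. real (k i) / 2 ^ j i) \<in> dyadic_rect j k"
  by (auto simp: dyadic_rect_def divide_strict_right_mono)

text \<open>Half an edge of the first rectangle must be shorter than a full edge of the second, and
  for integer exponents this gives the claim without loss. Rectangles of different shapes are
  therefore different sets, which is needed to count blocks through a point.\<close>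

lemma dyadic_rect_eq_imp_shape_le:
  fixes j k j' k' :: "'d::finite \<Rightarrow> nat"
  assumes eq: "dyadic_rect j k = dyadic_rect j' k'"
  shows "j' i \<le> j i"
proof -
  define s where "s = (\<chi> i. real (k i) / 2 ^ j i)"
  \<comment> \<open>The corner moved by half an edge in direction \<open>i\<close>; a full edge
    would leave the half-open rectangle.\<close>
  define s' where "s' = (\<chi> l. if l = i then (real (k i) + 1 / 2) / 2 ^ j i else s $ l)"
  have "s \<in> dyadic_rect j' k'"
    using dyadic_rect_corner[of k j] eq by (simp add: s_def)
  moreover have "s' \<in> dyadic_rect j k"
    by (auto simp: dyadic_rect_def s_def s'_def divide_strict_right_mono divide_right_mono)
  then have "s' \<in> dyadic_rect j' k'"
    using eq by simp
  ultimately have "s' $ i - s $ i < (real (k' i) + 1) / 2 ^ j' i - real (k' i) / 2 ^ j' i"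
    unfolding dyadic_rect_def by (smt (verit) mem_Collect_eq)
  also have "\<dots> = 1 / 2 ^ j' i"
    by (simp add: diff_divide_distrib[symmetric])
  also have "s' $ i - s $ i = 1 / 2 ^ Suc (j i)"
    by (simp add: s_def s'_def diff_divide_distrib[symmetric])
  finally have "(2::real) ^ j' i < 2 ^ Suc (j i)"
    by (simp add: divide_simps split: if_splits)
  then show ?thesis
    using power_less_imp_less_exp[of "2::real" "j' i" "Suc (j i)"] by simp
qed

lemma dyadic_rect_eq_imp_shape_eq:
  "dyadic_rect j k = dyadic_rect j' k' \<Longrightarrow> j = (j' :: 'd::finite \<Rightarrow> nat)"
  by (intro ext antisym dyadic_rect_eq_imp_shape_le) auto

lemma dyadic_rects_borel [measurable]: "(I :: (real ^ 'd) set) \<in> dyadic_rects \<Longrightarrow> I \<in> sets borel"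
  by (elim dyadic_rectsE) simp

lemma dyadic_rects_subset_cbox:
  assumes "(I :: (real ^ 'd) set) \<in> dyadic_rects"
  shows "I \<subseteq> cbox 0 1"
proof
  fix t assume t: "t \<in> I"
  obtain j k where jk: "\<And>i. k i < 2 ^ j i" "I = dyadic_rect j k"
    using assms by (rule dyadic_rectsE) blast
  have "0 \<le> t $ i \<and> t $ i \<le> 1" for i
  proof -
    have k: "real (k i) + 1 \<le> 2 ^ j i"
      using jk(1)[of i] by (metis Suc_leI add.commute of_nat_Suc of_nat_le_iff of_nat_numeral of_nat_power)
    have "real (k i) / 2 ^ j i \<le> t $ i" "t $ i < (real (k i) + 1) / 2 ^ j i"
      using t by (auto simp: jk dyadic_rect_def)
    moreover have "(real (k i) + 1) / 2 ^ j i \<le> 1"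
      using k by simp
    moreover have "0 \<le> real (k i) / 2 ^ j i" by simp
    ultimately show ?thesis by linarith
  qed
  then show "t \<in> cbox 0 1"
    by (simp add: mem_box_cart)
qed

lemma measure_dyadic_rects_pos:
  assumes "(I :: (real ^ 'd) set) \<in> dyadic_rects"
  shows "measure lborel I > 0"
  using assms by (elim dyadic_rectsE) (simp add: measure_dyadic_rect)

lemma emeasure_dyadic_rects:
  assumes "(I :: (real ^ 'd) set) \<in> dyadic_rects"
  shows "emeasure lborel I = ennreal (measure lborel I)"
  using assms by (elim dyadic_rectsE) (simp add: measure_dyadic_rect)

section \<open>The mixed norm\<close>

text \<open>Young's inequality with exponents \<open>r / (r - 1)\<close> and \<open>r\<close>,
  applied to \<open>a powr (r - 1)\<close> and \<open>b\<close>. The weights add up to 1, which is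
  what the normalised arguments below exploit.\<close>

lemma powr_Young:
  fixes a b r :: real
  assumes "a \<ge> 0" "b \<ge> 0" "r > 1"
  shows "a powr (r - 1) * b \<le> (1 - 1 / r) * a powr r + b powr r / r"
proof -
  have "a powr (r - 1) * b
      \<le> (a powr (r - 1)) powr (r / (r - 1)) / (r / (r - 1)) + b powr r / r"
    using assms by (intro Youngs_inequality) (auto simp: field_simps)
  also have "(a powr (r - 1)) powr (r / (r - 1)) / (r / (r - 1)) = (1 - 1 / r) * a powr r"
  proof -
    have "(r - 1) * (r / (r - 1)) = r" "1 / (r / (r - 1)) = 1 - 1 / r"
      using assms by (auto simp: field_simps)
    then show ?thesis
      by (metis powr_powr mult.commute times_divide_eq_right mult_1_right)
  qed
  finally show ?thesis .
qed

text \<open>After division by the two r-norms, \<open>powr_Young\<close> bounds each term, and the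
  bounds sum to (1 - 1/r) + 1/r = 1.\<close>

lemma sum_powr_Hoelder:
  fixes a b :: "'a \<Rightarrow> real" and r :: real
  assumes fin: "finite A" and r: "r > 1"
    and nonneg: "\<And>i. i \<in> A \<Longrightarrow> a i \<ge> 0" "\<And>i. i \<in> A \<Longrightarrow> b i \<ge> 0"
  shows "(\<Sum>i\<in>A. a i powr (r - 1) * b i)
    \<le> ((\<Sum>i\<in>A. a i powr r) powr (1 / r)) powr (r - 1) * (\<Sum>i\<in>A. b i powr r) powr (1 / r)"
proof -
  define s t where "s = (\<Sum>i\<in>A. a i powr r) powr (1 / r)" and "t = (\<Sum>i\<in>A. b i powr r) powr (1 / r)"
  have st: "s powr r = (\<Sum>i\<in>A. a i powr r)" "t powr r = (\<Sum>i\<in>A. b i powr r)"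
    using r by (auto simp: s_def t_def powr_powr sum_nonneg)
  show ?thesis
  proof (cases "s = 0 \<or> t = 0")
    \<comment> \<open>A vanishing norm cannot be divided out, but then all \<open>a i\<close> or all
      \<open>b i\<close> are 0.\<close>
    case True
    then have "(\<Sum>i\<in>A. a i powr r) = 0 \<or> (\<Sum>i\<in>A. b i powr r) = 0"
      using st r by auto
    then have "(\<forall>i\<in>A. a i = 0) \<or> (\<forall>i\<in>A. b i = 0)"
      using fin by (auto simp: sum_nonneg_eq_0_iff)
    then have "(\<Sum>i\<in>A. a i powr (r - 1) * b i) = 0"
      by auto
    then show ?thesis by simp
  next
    case False
    then have pos: "s > 0" "t > 0"
      using powr_ge_zero by (auto simp: s_def t_def less_le)
    have "(\<Sum>i\<in>A. (a i / s) powr (r - 1) * (b i / t))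
        \<le> (\<Sum>i\<in>A. (1 - 1 / r) * (a i / s) powr r + (b i / t) powr r / r)"
      using nonneg r pos by (intro sum_mono powr_Young) auto
    also have "\<dots> = (1 - 1 / r) * (\<Sum>i\<in>A. a i powr r) / s powr r + (\<Sum>i\<in>A. b i powr r) / t powr r / r"
      using nonneg pos
      by (simp add: sum.distrib sum_distrib_left[symmetric] sum_divide_distrib[symmetric] powr_divide)
    also have "\<dots> = 1"
      using pos r by (simp flip: st)
    finally have "(\<Sum>i\<in>A. (a i / s) powr (r - 1) * (b i / t)) \<le> 1" .
    moreover have "(\<Sum>i\<in>A. (a i / s) powr (r - 1) * (b i / t))
        = (\<Sum>i\<in>A. a i powr (r - 1) * b i) / (s powr (r - 1) * t)"
      unfolding sum_divide_distrib using nonneg pos by (intro sum.cong) (auto simp: powr_divide)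
    ultimately show ?thesis
      using pos by (simp add: pos_divide_le_eq flip: s_def t_def)
  qed
qed

section \<open>Reduction of the norm to integrals over finite families\<close>

lemma ennreal_powr_ennreal: "x \<ge> 0 \<Longrightarrow> ennreal_powr (ennreal x) r = ennreal (x powr r)"
  by (simp add: ennreal_powr_def)

lemma ennreal_powr_mono:
  assumes "a \<le> b" "r \<ge> 0"
  shows "ennreal_powr a r \<le> ennreal_powr b r"
proof (cases "b = \<infinity>")
  case False
  then have "a \<noteq> \<infinity>"
    using assms(1) by (auto simp: top_unique)
  with False show ?thesis
    using assms
    by (auto simp: ennreal_powr_def less_top intro!: ennreal_leI powr_mono2 enn2real_mono)
qed (simp add: ennreal_powr_def)

lemma normalized_indicator_nonneg: "normalized_indicator p I t \<ge> 0"
  by (simp add: normalized_indicator_def)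

lemma norm_mult_of_real_normalized_indicator:
  "norm (c * of_real (normalized_indicator p I t) :: 'k::real_normed_field)
     = norm c * normalized_indicator p I t"
  by (simp add: norm_mult normalized_indicator_nonneg)

text \<open>Every operation in the norm is monotone in the moduli of the coefficients. This lattice
  property later makes truncation a best approximation.\<close>

lemma f_enorm_mono:
  fixes x y :: "(real ^ 'd) set \<Rightarrow> 'k::real_normed_field"
  assumes le: "\<And>I. I \<in> dyadic_rects \<Longrightarrow> norm (x I) \<le> norm (y I)" and "p > 0" "q > 0"
  shows "f_enorm p q x \<le> f_enorm p q y"
  unfolding f_enorm_def norm_mult_of_real_normalized_indicator
  using assms(2,3)
  by (intro ennreal_powr_mono nn_integral_mono mult_right_mono infsum_mono ennreal_leI powr_mono2
       mult_right_mono le nonneg_summable_on_complete)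
     (auto simp: normalized_indicator_nonneg)

text \<open>The pointwise ell^q norm of a finite family, for q = 2 a square function. Being
  real-valued, it can be handled with Bochner integrals, whereas the norm is defined through
  extended reals.\<close>

definition sq_fun :: "real \<Rightarrow> real \<Rightarrow> (real ^ 'd) set set \<Rightarrow> ((real ^ 'd) set \<Rightarrow> real) \<Rightarrow> real ^ 'd \<Rightarrow> real"
  where "sq_fun p q R w t = (\<Sum>I\<in>R. (w I * normalized_indicator p I t) powr q) powr (1 / q)"

lemma sq_fun_nonneg: "sq_fun p q R w t \<ge> 0"
  by (simp add: sq_fun_def)

lemma sq_fun_powr_q: "q > 0 \<Longrightarrow> sq_fun p q R w t powr q = (\<Sum>I\<in>R. (w I * normalized_indicator p I t) powr q)"
  by (simp add: sq_fun_def powr_powr sum_nonneg)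

lemma normalized_indicator_measurable:
  "(I :: (real ^ 'd) set) \<in> dyadic_rects \<Longrightarrow> normalized_indicator p I \<in> borel_measurable borel"
  unfolding normalized_indicator_def[abs_def] by measurable

lemma sq_fun_measurable:
  fixes R :: "(real ^ 'd) set set"
  assumes "R \<subseteq> dyadic_rects"
  shows "sq_fun p q R w \<in> borel_measurable borel"
  unfolding sq_fun_def[abs_def] using assms
  by (intro powr_real_measurable borel_measurable_sum borel_measurable_times
      normalized_indicator_measurable borel_measurable_const) auto

lemma normalized_indicator_outside:
  "I \<in> dyadic_rects \<Longrightarrow> t \<notin> cbox 0 1 \<Longrightarrow> normalized_indicator p (I :: (real ^ 'd) set) t = 0"
  using dyadic_rects_subset_cbox[of I] by (auto simp: normalized_indicator_def indicator_def)

lemma sq_fun_outside: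
  fixes R :: "(real ^ 'd) set set"
  assumes "R \<subseteq> dyadic_rects" "t \<notin> cbox 0 1"
  shows "sq_fun p q R w t = 0"
  unfolding sq_fun_def using assms by (subst sum.neutral) (auto simp: normalized_indicator_outside)

lemma integrable_unit_cube:
  fixes f :: "real ^ 'd \<Rightarrow> real"
  assumes "f \<in> borel_measurable borel" "\<And>t. \<bar>f t\<bar> \<le> B" "\<And>t. t \<notin> cbox 0 1 \<Longrightarrow> f t = 0"
  shows "integrable lborel f"
  using assms
  by (intro integrableI_bounded_set[of "cbox 0 1" _ _ B]) (auto simp: emeasure_lborel_cbox_finite simp flip: infinity_ennreal_def)

lemma integrable_sq_fun:
  fixes R :: "(real ^ 'd) set set"
  assumes "finite R" "R \<subseteq> dyadic_rects" "p > 0" "q > 0" "\<And>I. w I \<ge> 0"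
  shows "integrable lborel (\<lambda>t. sq_fun p q R w t powr p)"
proof (rule integrable_unit_cube)
  show "(\<lambda>t. sq_fun p q R w t powr p) \<in> borel_measurable borel"
    using sq_fun_measurable[OF assms(2)] by measurable
  \<comment> \<open>Replacing every indicator by 1 gives a bound independent of
    \<open>t\<close>.\<close>
  show "\<bar>sq_fun p q R w t powr p\<bar> \<le>
      ((\<Sum>I\<in>R. (w I * measure lborel I powr (- 1 / p)) powr q) powr (1 / q)) powr p" for t
    using assms unfolding sq_fun_def
    by (auto intro!: powr_mono2 sum_mono mult_left_mono sum_nonneg mult_nonneg_nonneg
        simp: normalized_indicator_def indicator_def)
  show "sq_fun p q R w t powr p = 0" if "t \<notin> cbox 0 1" for t
    using sq_fun_outside[OF assms(2) that] by simp
qed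

lemma f_enorm_finite_support:
  fixes x :: "(real ^ 'd) set \<Rightarrow> 'k::real_normed_field"
  assumes R: "finite R" "R \<subseteq> dyadic_rects" and pq: "p > 0" "q > 0"
    and supp: "\<And>I. I \<notin> R \<Longrightarrow> x I = 0"
  shows "f_enorm p q x =
    ennreal ((\<integral>t. sq_fun p q R (\<lambda>I. norm (x I)) t powr p \<partial>lborel) powr (1 / p))"
proof -
  let ?S = "sq_fun p q R (\<lambda>I. norm (x I))"
  have "ennreal_powr (ennreal_powr
          (\<Sum>\<^sub>\<infinity>I\<in>dyadic_rects. ennreal (norm (x I * of_real (normalized_indicator p I t)) powr q))
          (1 / q)) p = ennreal (?S t powr p)" for t
  proof -
    have "(\<Sum>\<^sub>\<infinity>I\<in>dyadic_rects. ennreal (norm (x I * of_real (normalized_indicator p I t)) powr q))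
        = (\<Sum>\<^sub>\<infinity>I\<in>R. ennreal (norm (x I * of_real (normalized_indicator p I t)) powr q))"
      using R supp by (intro infsum_cong_neutral) auto
    also have "\<dots> = ennreal (\<Sum>I\<in>R. (norm (x I) * normalized_indicator p I t) powr q)"
      using R by (simp add: norm_mult_of_real_normalized_indicator)
    finally show ?thesis
      by (simp add: ennreal_powr_ennreal sum_nonneg sq_fun_def)
  qed
  moreover have "ennreal (?S t powr p) * indicator (cbox 0 1) t = ennreal (?S t powr p)" for t
    using sq_fun_outside[OF R(2), of t p q] by (auto simp: indicator_def)
  ultimately have "f_enorm p q x = ennreal_powr (\<integral>\<^sup>+ t. ennreal (?S t powr p) \<partial>lborel) (1 / p)"
    unfolding f_enorm_def by simp
  also have "(\<integral>\<^sup>+ t. ennreal (?S t powr p) \<partial>lborel) = ennreal (\<integral>t. ?S t powr p \<partial>lborel)"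
    using R pq by (intro nn_integral_eq_integral integrable_sq_fun) auto
  finally show ?thesis
    by (simp add: ennreal_powr_ennreal)
qed

lemma f_norm_finite_support:
  fixes x :: "(real ^ 'd) set \<Rightarrow> 'k::real_normed_field"
  assumes "finite R" "R \<subseteq> dyadic_rects" "p > 0" "q > 0" "\<And>I. I \<notin> R \<Longrightarrow> x I = 0"
  shows "f_norm p q x = (\<integral>t. sq_fun p q R (\<lambda>I. norm (x I)) t powr p \<partial>lborel) powr (1 / p)"
  using f_enorm_finite_support[of R p q x] assms by (simp add: f_norm_def)

lemma f_norm_powr_finite_support:
  fixes x :: "(real ^ 'd) set \<Rightarrow> 'k::real_normed_field"
  assumes "finite R" "R \<subseteq> dyadic_rects" "p > 0" "q > 0" "\<And>I. I \<notin> R \<Longrightarrow> x I = 0"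
  shows "f_norm p q x powr p = (\<integral>t. sq_fun p q R (\<lambda>I. norm (x I)) t powr p \<partial>lborel)"
  using f_norm_finite_support[of R p q x] assms by (simp add: powr_powr)

lemma f_norm_mono:
  fixes x y :: "(real ^ 'd) set \<Rightarrow> 'k::real_normed_field"
  assumes "\<And>I. norm (x I) \<le> norm (y I)" "y \<in> f_space p q" "p > 0" "q > 0"
  shows "f_norm p q x \<le> f_norm p q y"
  using assms f_enorm_mono[of x y p q] unfolding f_norm_def f_space_def
  by (intro enn2real_mono) auto

lemma finite_support_in_f_space:
  fixes x :: "(real ^ 'd) set \<Rightarrow> 'k::real_normed_field"
  assumes "finite R" "R \<subseteq> dyadic_rects" "p > 0" "q > 0" "\<And>I. I \<notin> R \<Longrightarrow> x I = 0"
  shows "x \<in> f_space p q"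
  using assms f_enorm_finite_support[OF assms] by (auto simp: f_space_def)

lemma f_norm_nonneg: "f_norm p q x \<ge> 0"
  by (simp add: f_norm_def)

text \<open>A normalised indicator has L^p norm 1, so \<open>norm (x I)\<close> is the norm of the
  \<open>I\<close>-th coordinate part of \<open>x\<close>, and the lattice property applies.
  Positivity of norms and boundedness of functionals below rest on this.\<close>

lemma norm_coeff_le_f_norm:
  fixes x :: "(real ^ 'd) set \<Rightarrow> 'k::real_normed_field"
  assumes x: "x \<in> f_space p q" and pq: "p > 0" "q > 0"
  shows "norm (x I) \<le> f_norm p q x"
proof (cases "I \<in> dyadic_rects")
  case True
  define y where "y = (\<lambda>J. if J = I then x I else 0)"
  have m: "measure lborel I > 0"
    using True by (rule measure_dyadic_rects_pos)
  have "sq_fun p q {I} (\<lambda>J. norm (y J)) t powr p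
      = norm (x I) powr p / measure lborel I * indicator I t" for t
    using pq m
    by (auto simp: sq_fun_def y_def normalized_indicator_def powr_powr powr_mult powr_divide powr_minus_divide indicator_def)
  then have "f_norm p q y powr p = norm (x I) powr p"
    using True pq m emeasure_dyadic_rects[OF True]
    by (subst f_norm_powr_finite_support[of "{I}"]) (auto simp: y_def)
  then have "norm (x I) = f_norm p q y"
    using pq by (metis f_norm_nonneg norm_ge_zero powr_inj less_irrefl powr_powr powr_one_gt_zero_iff
      nonzero_divide_eq_eq powr_one mult.commute)
  also have "\<dots> \<le> f_norm p q x"
    using x pq by (intro f_norm_mono) (auto simp: y_def)
  finally show ?thesis .
next
  case False
  then show ?thesis
    using x by (simp add: f_space_def f_norm_nonneg)
qed

section \<open>Norming functionals\<close>

lemma le_sq_fun: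
  assumes "finite R" "I \<in> R" "q > 0" "w I \<ge> 0"
  shows "w I * normalized_indicator p I t \<le> sq_fun p q R w t"
proof -
  let ?a = "w I * normalized_indicator p I t"
  have a: "?a \<ge> 0"
    using assms by (simp add: normalized_indicator_nonneg)
  have "?a powr q \<le> (\<Sum>I\<in>R. (w I * normalized_indicator p I t) powr q)"
    using assms by (intro member_le_sum) auto
  then have "(?a powr q) powr (1 / q) \<le> sq_fun p q R w t"
    unfolding sq_fun_def using assms by (intro powr_mono2) auto
  then show ?thesis
    using a assms by (simp add: powr_powr)
qed

lemma sq_fun_mult:
  assumes "c \<ge> 0" "q > 0" "\<And>I. I \<in> R \<Longrightarrow> w I \<ge> 0"
  shows "sq_fun p q R (\<lambda>I. c * w I) t = c * sq_fun p q R w t"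
proof -
  have "(\<Sum>I\<in>R. (c * w I * normalized_indicator p I t) powr q)
      = c powr q * (\<Sum>I\<in>R. (w I * normalized_indicator p I t) powr q)"
    using assms by (simp add: sum_distrib_left mult.assoc powr_mult normalized_indicator_nonneg)
  then show ?thesis
    using assms by (simp add: sq_fun_def powr_mult powr_powr sum_nonneg)
qed

lemma sq_fun_cong: "(\<And>I. I \<in> R \<Longrightarrow> w I = v I) \<Longrightarrow> sq_fun p q R w = sq_fun p q R v"
  by (auto simp: sq_fun_def fun_eq_iff intro!: arg_cong[where f = "\<lambda>s. s powr _"] sum.cong)

text \<open>Real weights suffice: the input, the approximants and the remainders of the run
  constructed below all have this form.\<close>

definition restr :: "'i set \<Rightarrow> ('i \<Rightarrow> real) \<Rightarrow> 'i \<Rightarrow> 'k::real_normed_field" where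
  "restr R w I = (if I \<in> R then of_real (w I) else 0)"

text \<open>Up to a constant factor, this is the derivative of the norm at \<open>restr R w\<close> in the direction
  of the \<open>I\<close>-th basis vector.\<close>

definition norming_coeff ::
  "real \<Rightarrow> real \<Rightarrow> (real ^ 'd) set set \<Rightarrow> ((real ^ 'd) set \<Rightarrow> real) \<Rightarrow> (real ^ 'd) set \<Rightarrow> real" where
  "norming_coeff p q R w I =
     (\<integral>t. (w I * normalized_indicator p I t) powr (q - 1) * normalized_indicator p I t
          * sq_fun p q R w t powr (p - q) \<partial>lborel)"

lemma norming_coeff_nonneg: "norming_coeff p q R w I \<ge> 0"
  unfolding norming_coeff_def by (simp add: normalized_indicator_nonneg)

locale mixed_exponents =
  fixes p q :: real
  assumes p: "1 < p" and p_le_q: "p \<le> q"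
begin

lemma q: "1 < q"
  using p p_le_q by simp

lemma exponents_pos [simp]: "p > 0" "q > 0" "p \<ge> 0" "q \<ge> 0" "p \<noteq> 0" "q \<noteq> 0"
  using p q by auto

lemma f_norm_restr_powr:
  fixes R :: "(real ^ 'd) set set"
  assumes "finite R" "R \<subseteq> dyadic_rects" "\<And>I. I \<in> R \<Longrightarrow> w I \<ge> 0"
  shows "f_norm p q (restr R w :: _ \<Rightarrow> 'k::real_normed_field) powr p
    = (\<integral>t. sq_fun p q R w t powr p \<partial>lborel)"
proof -
  have "sq_fun p q R (\<lambda>I. norm (restr R w I :: 'k)) = sq_fun p q R w"
    using assms by (intro sq_fun_cong) (auto simp: restr_def)
  then show ?thesis
    using f_norm_powr_finite_support[of R p q "restr R w :: _ \<Rightarrow> 'k"] assms by (simp add: restr_def)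
qed

lemma restr_in_f_space:
  "finite R \<Longrightarrow> R \<subseteq> dyadic_rects \<Longrightarrow> (restr R w :: (real ^ 'd) set \<Rightarrow> 'k::real_normed_field) \<in> f_space p q"
  by (rule finite_support_in_f_space[of R]) (auto simp: restr_def)

lemma f_norm_restr_pos:
  fixes R :: "(real ^ 'd) set set"
  assumes "finite R" "R \<subseteq> dyadic_rects" "R \<noteq> {}" "\<And>I. I \<in> R \<Longrightarrow> w I > 0"
  shows "f_norm p q (restr R w :: _ \<Rightarrow> 'k::real_normed_field) > 0"
proof -
  obtain I where "I \<in> R" using assms by auto
  then have "w I \<le> f_norm p q (restr R w :: _ \<Rightarrow> 'k)" "w I > 0"
    using norm_coeff_le_f_norm[OF restr_in_f_space[OF assms(1,2)], of w I] assms(4)[of I]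
    by (auto simp: restr_def)
  then show ?thesis by linarith
qed

context
  fixes R :: "(real ^ 'd) set set" and w :: "(real ^ 'd) set \<Rightarrow> real"
  assumes R: "finite R" "R \<subseteq> dyadic_rects" and w: "\<And>I. I \<in> R \<Longrightarrow> w I > 0"
begin

text \<open>Since \<open>p - q\<close> is not positive, the last factor could be large where the
  square function is small. But the integrand lives on \<open>I\<close>, where the square function
  is at least the contribution of \<open>I\<close> itself.\<close>

lemma integrable_norming_coeff:
  assumes I: "I \<in> R"
  shows "integrable lborel (\<lambda>t. (w I * normalized_indicator p I t) powr (q - 1)
     * normalized_indicator p I t * sq_fun p q R w t powr (p - q))"
proof (rule integrable_unit_cube)
  have I': "I \<in> dyadic_rects" using I R by auto
  show "(\<lambda>t. (w I * normalized_indicator p I t) powr (q - 1)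
     * normalized_indicator p I t * sq_fun p q R w t powr (p - q)) \<in> borel_measurable borel"
    using sq_fun_measurable[OF R(2)] normalized_indicator_measurable[OF I'] by measurable
  define c where "c = measure lborel I powr (- 1 / p)"
  have c: "c > 0"
    using measure_dyadic_rects_pos[OF I'] by (simp add: c_def)
  have wI: "w I > 0" using w[OF I] .
  show "\<bar>(w I * normalized_indicator p I t) powr (q - 1)
     * normalized_indicator p I t * sq_fun p q R w t powr (p - q)\<bar>
     \<le> (w I * c) powr (q - 1) * c * (w I * c) powr (p - q)" for t
  proof (cases "t \<in> I")
    case True
    then have n: "normalized_indicator p I t = c"
      by (simp add: normalized_indicator_def c_def)
    then have "w I * c \<le> sq_fun p q R w t"
      using le_sq_fun[of R I q w p t] R I wI by simp
    then have "sq_fun p q R w t powr (p - q) \<le> (w I * c) powr (p - q)"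
      using wI c p_le_q by (intro powr_mono2') auto
    then show ?thesis
      using c unfolding n by (simp add: abs_mult mult_left_mono)
  qed (use c in \<open>simp add: normalized_indicator_def\<close>)
  show "(w I * normalized_indicator p I t) powr (q - 1)
     * normalized_indicator p I t * sq_fun p q R w t powr (p - q) = 0" if "t \<notin> cbox 0 1" for t
    using that I' by (simp add: normalized_indicator_outside)
qed

lemma sum_norming_coeff:
  "(\<Sum>I\<in>R. norming_coeff p q R w I * v I)
    = (\<integral>t. (\<Sum>I\<in>R. (w I * normalized_indicator p I t) powr (q - 1) * (v I * normalized_indicator p I t))
         * sq_fun p q R w t powr (p - q) \<partial>lborel)"
  (is "_ = ?r")
  and integrable_sum_norming_coeff: "integrable lborel
    (\<lambda>t. (\<Sum>I\<in>R. (w I * normalized_indicator p I t) powr (q - 1) * (v I * normalized_indicator p I t))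
         * sq_fun p q R w t powr (p - q))"
proof -
  have *: "(\<Sum>I\<in>R. (w I * normalized_indicator p I t) powr (q - 1) * (v I * normalized_indicator p I t))
         * sq_fun p q R w t powr (p - q)
     = (\<Sum>I\<in>R. ((w I * normalized_indicator p I t) powr (q - 1) * normalized_indicator p I t
         * sq_fun p q R w t powr (p - q)) * v I)" for t
    unfolding sum_distrib_right by (simp add: mult_ac)
  show "(\<Sum>I\<in>R. norming_coeff p q R w I * v I) = ?r"
    unfolding * norming_coeff_def
    by (subst Bochner_Integration.integral_sum)
       (auto intro!: integrable_norming_coeff)
  show "integrable lborel (\<lambda>t. (\<Sum>I\<in>R. (w I * normalized_indicator p I t) powr (q - 1) * (v I * normalized_indicator p I t))
         * sq_fun p q R w t powr (p - q))"
    unfolding * by (intro Bochner_Integration.integrable_sum integrable_mult_left integrable_norming_coeff)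
qed

text \<open>Paired with \<open>w\<close>, the inner sum becomes the q-th power of the square
  function, and the exponents q and p - q add up to p.\<close>

lemma sum_norming_coeff_self:
  "(\<Sum>I\<in>R. norming_coeff p q R w I * w I) = (\<integral>t. sq_fun p q R w t powr p \<partial>lborel)"
proof -
  have "(\<Sum>I\<in>R. (w I * normalized_indicator p I t) powr (q - 1) * (w I * normalized_indicator p I t))
         * sq_fun p q R w t powr (p - q) = sq_fun p q R w t powr p" for t
  proof -
    have "(\<Sum>I\<in>R. (w I * normalized_indicator p I t) powr (q - 1) * (w I * normalized_indicator p I t))
        = sq_fun p q R w t powr q"
      unfolding sq_fun_powr_q[OF exponents_pos(2)]
    proof (rule sum.cong)
      fix I assume "I \<in> R"
      then have "w I * normalized_indicator p I t \<ge> 0"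
        using w[of I] by (simp add: normalized_indicator_nonneg)
      then show "(w I * normalized_indicator p I t) powr (q - 1) * (w I * normalized_indicator p I t)
          = (w I * normalized_indicator p I t) powr q"
        using q by (cases "w I * normalized_indicator p I t = 0") (auto simp: powr_diff)
    qed simp
    then show ?thesis
      by (simp flip: powr_add)
  qed
  then show ?thesis
    by (simp add: sum_norming_coeff)
qed

text \<open>Hoelder's inequality for the inner and Young's inequality for the outer exponent.\<close>

lemma sum_norming_coeff_le:
  assumes v: "\<And>I. I \<in> R \<Longrightarrow> v I \<ge> 0" and v1: "(\<integral>t. sq_fun p q R v t powr p \<partial>lborel) \<le> 1"
    and X: "X > 0" "X powr p = (\<integral>t. sq_fun p q R w t powr p \<partial>lborel)"
  shows "(\<Sum>I\<in>R. norming_coeff p q R w I * v I) \<le> X powr (p - 1)"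
proof -
  let ?S = "sq_fun p q R w" and ?V = "sq_fun p q R v"
  have "w I \<ge> 0" if "I \<in> R" for I using w[OF that] by simp
  then have pw: "(\<Sum>I\<in>R. (w I * normalized_indicator p I t) powr (q - 1) * (v I * normalized_indicator p I t))
         * ?S t powr (p - q)
       \<le> X powr (p - 1) * ((1 - 1 / p) / X powr p * ?S t powr p + ?V t powr p / p)" for t
  proof -
    have "(\<Sum>I\<in>R. (w I * normalized_indicator p I t) powr (q - 1) * (v I * normalized_indicator p I t))
         * ?S t powr (p - q) \<le> (?S t powr (q - 1) * ?V t) * ?S t powr (p - q)"
      unfolding sq_fun_def using R q v \<open>\<And>I. I \<in> R \<Longrightarrow> w I \<ge> 0\<close>
      by (intro mult_right_mono sum_powr_Hoelder) (auto simp: normalized_indicator_nonneg)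
    also have "\<dots> = ?S t powr (p - 1) * ?V t"
      by (simp add: mult_ac flip: powr_add)
    \<comment> \<open>Division by \<open>X\<close> normalises the L^p norm of the square function,
      so that the two terms of Young's inequality integrate to at most 1 - 1/p and 1/p.\<close>
    also have "\<dots> = X powr (p - 1) * ((?S t / X) powr (p - 1) * ?V t)"
      using X by (simp add: powr_divide sq_fun_nonneg)
    also have "\<dots> \<le> X powr (p - 1) * ((1 - 1 / p) * (?S t / X) powr p + ?V t powr p / p)"
      using X p by (intro mult_left_mono powr_Young) (auto simp: sq_fun_nonneg)
    finally show ?thesis
      using X by (simp add: powr_divide sq_fun_nonneg)
  qed
  have int: "integrable lborel (\<lambda>t. ?S t powr p)" "integrable lborel (\<lambda>t. ?V t powr p)"
  proof -
    \<comment> \<open>\<open>integrable_sq_fun\<close> asks for weights that are nonnegative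
      everywhere, not only on \<open>R\<close>.\<close>
    have "sq_fun p q R w = sq_fun p q R (\<lambda>I. \<bar>w I\<bar>)" "sq_fun p q R v = sq_fun p q R (\<lambda>I. \<bar>v I\<bar>)"
      using w v by (auto intro!: sq_fun_cong simp: less_imp_le)
    then show "integrable lborel (\<lambda>t. ?S t powr p)" "integrable lborel (\<lambda>t. ?V t powr p)"
      using integrable_sq_fun[OF R exponents_pos(1,2)] by auto
  qed
  have "(\<Sum>I\<in>R. norming_coeff p q R w I * v I)
      \<le> (\<integral>t. X powr (p - 1) * ((1 - 1 / p) / X powr p * ?S t powr p + ?V t powr p / p) \<partial>lborel)"
    unfolding sum_norming_coeff using int
    by (intro integral_mono integrable_sum_norming_coeff pw) auto
  also have "\<dots> = X powr (p - 1) *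
      ((1 - 1 / p) / X powr p * (\<integral>t. ?S t powr p \<partial>lborel) + (\<integral>t. ?V t powr p \<partial>lborel) / p)"
    using int by simp
  also have "\<dots> = X powr (p - 1) * ((1 - 1 / p) + (\<integral>t. ?V t powr p \<partial>lborel) / p)"
    using X by (simp flip: X(2))
  also have "\<dots> \<le> X powr (p - 1) * ((1 - 1 / p) + 1 / p)"
    using v1 p by (intro mult_left_mono add_left_mono divide_right_mono) auto
  finally show ?thesis by simp
qed

end

end

section \<open>Truncated vectors and their norming functionals\<close>

lemma restr_empty [simp]: "restr {} w = 0"
  by (simp add: restr_def fun_eq_iff)

lemma restr_insert:
  "I \<notin> E \<Longrightarrow> restr (insert I E) w = scale_fun (of_real (w I)) (unit_seq I) + restr E w"
  by (auto simp: restr_def fun_eq_iff scale_fun_def unit_seq_def)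

lemma restr_in_span:
  "finite E \<Longrightarrow> (restr E w :: _ \<Rightarrow> 'k::real_normed_field) \<in> fun_vs.span (unit_seq ` E)"
proof (induction rule: finite_induct)
  case (insert I E)
  have "(restr E w :: _ \<Rightarrow> 'k) \<in> fun_vs.span (unit_seq ` insert I E)"
    by (rule subsetD[OF fun_vs.span_mono[OF image_mono[OF subset_insertI]] insert.IH])
  then show ?case
    unfolding restr_insert[OF insert.hyps(2)]
    by (rule fun_vs.span_add[OF fun_vs.span_scale[OF fun_vs.span_base[OF imageI[OF insertI1]]]])
qed (simp add: fun_eq_iff)

lemma span_unit_seq_outside:
  assumes "a \<in> fun_vs.span (unit_seq ` E)" "I \<notin> E"
  shows "a I = 0"
  using assms(1)
proof (induction rule: fun_vs.span_induct_alt)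
  case (step c x y)
  then show ?case using assms(2) by (auto simp: scale_fun_def unit_seq_def split: if_splits)
qed simp

lemma restr_minus_restr: "E \<subseteq> T \<Longrightarrow> restr T w - restr E w = restr (T - E) w"
  by (auto simp: restr_def fun_eq_iff)

text \<open>The coefficients form the gradient of \<open>f_norm p q x powr p / p\<close>; dividing
  by the power p - 1 of the norm turns it into the gradient of the norm itself.\<close>

definition norming_fun ::
  "real \<Rightarrow> real \<Rightarrow> (real ^ 'd) set set \<Rightarrow> ((real ^ 'd) set \<Rightarrow> real) \<Rightarrow>
   ((real ^ 'd) set \<Rightarrow> 'k::real_normed_field) \<Rightarrow> 'k" where
  "norming_fun p q R w y =
     of_real (f_norm p q (restr R w :: _ \<Rightarrow> 'k) powr (1 - p))
       * (\<Sum>I\<in>R. of_real (norming_coeff p q R w I) * y I)"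

lemma norming_fun_unit_seq:
  assumes "finite R"
  shows "norming_fun p q R w (unit_seq J :: (real ^ 'd) set \<Rightarrow> 'k::real_normed_field) =
    of_real (f_norm p q (restr R w :: _ \<Rightarrow> 'k) powr (1 - p) * (if J \<in> R then norming_coeff p q R w J else 0))"
proof -
  have "(\<Sum>I\<in>R. of_real (norming_coeff p q R w I) * (unit_seq J I :: 'k))
      = (\<Sum>I\<in>R. if I = J then of_real (norming_coeff p q R w I) else 0)"
    by (intro sum.cong) (auto simp: unit_seq_def)
  then show ?thesis
    using assms by (simp add: norming_fun_def)
qed

context mixed_exponents
begin

context
  fixes R :: "(real ^ 'd) set set" and w :: "(real ^ 'd) set \<Rightarrow> real"
  assumes R: "finite R" "R \<subseteq> dyadic_rects" and w: "\<And>I. I \<in> R \<Longrightarrow> w I > 0"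
begin

lemma norm_norming_fun_le:
  "norm (norming_fun p q R w (y :: _ \<Rightarrow> 'k::real_normed_field))
    \<le> f_norm p q (restr R w :: _ \<Rightarrow> 'k) powr (1 - p) * (\<Sum>I\<in>R. norming_coeff p q R w I * norm (y I))"
  unfolding norming_fun_def norm_mult
  by (auto intro!: mult_left_mono order_trans[OF norm_sum] sum_mono
      simp: norm_mult norming_coeff_nonneg)

lemma norming_fun_self:
  "norming_fun p q R w (restr R w) = (of_real (f_norm p q (restr R w :: _ \<Rightarrow> 'k)) :: 'k::real_normed_field)"
proof -
  let ?X = "f_norm p q (restr R w :: _ \<Rightarrow> 'k)"
  have "(\<Sum>I\<in>R. of_real (norming_coeff p q R w I) * (restr R w I :: 'k))
      = of_real (\<Sum>I\<in>R. norming_coeff p q R w I * w I)"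
    by (simp add: restr_def)
  also have "(\<Sum>I\<in>R. norming_coeff p q R w I * w I) = ?X powr p"
    using sum_norming_coeff_self[OF R w] f_norm_restr_powr[where ?'k = 'k, OF R, of w] w
    by (simp add: less_imp_le)
  finally have "norming_fun p q R w (restr R w) = (of_real (?X powr (1 - p) * ?X powr p) :: 'k)"
    by (simp add: norming_fun_def)
  then show ?thesis
    using f_norm_nonneg[of p q "restr R w :: _ \<Rightarrow> 'k"] by (simp flip: powr_add)
qed

text \<open>Only the moduli of \<open>y\<close> on \<open>R\<close> matter, and passing to them does
  not increase the norm. The bound of \<open>sum_norming_coeff_le\<close> then cancels against the
  normalising factor.\<close>

lemma norm_norming_fun_le_1:
  assumes y: "y \<in> f_space p q" "f_norm p q y \<le> 1" and "R \<noteq> {}"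
  shows "norm (norming_fun p q R w (y :: _ \<Rightarrow> 'k::real_normed_field)) \<le> 1"
proof -
  let ?X = "f_norm p q (restr R w :: _ \<Rightarrow> 'k)"
  have X: "?X > 0"
    using f_norm_restr_pos[OF R assms(3) w] .
  define z where "z = (restr R (\<lambda>I. norm (y I)) :: _ \<Rightarrow> 'k)"
  have "f_norm p q z \<le> f_norm p q y"
    using y(1) by (intro f_norm_mono) (auto simp: z_def restr_def)
  then have "f_norm p q z powr p \<le> 1"
    using y(2) powr_mono2[of p "f_norm p q z" 1] by (simp add: f_norm_nonneg)
  then have "(\<integral>t. sq_fun p q R (\<lambda>I. norm (y I)) t powr p \<partial>lborel) \<le> 1"
    unfolding z_def using f_norm_restr_powr[where ?'k = 'k, OF R, of "\<lambda>I. norm (y I)"] by simp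
  then have "(\<Sum>I\<in>R. norming_coeff p q R w I * norm (y I)) \<le> ?X powr (p - 1)"
    using X f_norm_restr_powr[where ?'k = 'k, OF R, of w] w
    by (intro sum_norming_coeff_le R w) (auto simp: less_imp_le)
  then have "?X powr (1 - p) * (\<Sum>I\<in>R. norming_coeff p q R w I * norm (y I))
      \<le> ?X powr (1 - p) * ?X powr (p - 1)"
    by (intro mult_left_mono) auto
  also have "\<dots> = 1"
    using X by (simp flip: powr_add)
  finally show ?thesis
    using norm_norming_fun_le[of y] by linarith
qed

text \<open>The dual norm is a maximum: it is attained at \<open>restr R w\<close> divided by its
  norm.\<close>

lemma norming_functional_norming_fun:
  assumes "R \<noteq> {}"
  shows "norming_functional (f_space p q) (f_norm p q) (restr R w)
     (norming_fun p q R w :: (_ \<Rightarrow> 'k::real_normed_field) \<Rightarrow> 'k)"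
proof -
  let ?X = "f_norm p q (restr R w :: _ \<Rightarrow> 'k)" and ?F = "norming_fun p q R w :: (_ \<Rightarrow> 'k) \<Rightarrow> 'k"
  have X: "?X > 0"
    using f_norm_restr_pos[OF R assms w] .
  have add: "?F (x + y) = ?F x + ?F y" for x y
    by (simp add: norming_fun_def algebra_simps sum.distrib)
  have scale: "?F (scale_fun c x) = c * ?F x" for c x
    by (simp add: norming_fun_def scale_fun_def sum_distrib_left mult_ac)
  \<comment> \<open>For boundedness a crude constant suffices, so each coordinate is estimated by
    the full norm.\<close>
  have "norm (?F x) \<le> ?X powr (1 - p) * (\<Sum>I\<in>R. norming_coeff p q R w I) * f_norm p q x"
    if "x \<in> f_space p q" for x
  proof -
    have "(\<Sum>I\<in>R. norming_coeff p q R w I * norm (x I))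
        \<le> (\<Sum>I\<in>R. norming_coeff p q R w I * f_norm p q x)"
      using that by (intro sum_mono mult_left_mono norm_coeff_le_f_norm norming_coeff_nonneg) auto
    then have "?X powr (1 - p) * (\<Sum>I\<in>R. norming_coeff p q R w I * norm (x I))
        \<le> ?X powr (1 - p) * ((\<Sum>I\<in>R. norming_coeff p q R w I) * f_norm p q x)"
      by (intro mult_left_mono) (auto simp: sum_distrib_right)
    then show ?thesis
      using norm_norming_fun_le[of x] by (simp add: mult.assoc)
  qed
  then have bounded: "bounded_functional_on (f_space p q) (f_norm p q) ?F"
    unfolding bounded_functional_on_def using add scale by blast
  have "dual_norm (f_space p q) (f_norm p q) ?F = 1"
    unfolding dual_norm_def
  proof (rule cSup_eq_maximum)
    define z where "z = (restr R (\<lambda>I. inverse ?X * w I) :: _ \<Rightarrow> 'k)"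
    have z: "z = scale_fun (of_real (inverse ?X)) (restr R w)"
      by (auto simp: z_def restr_def scale_fun_def fun_eq_iff)
    have "f_norm p q z powr p = (\<integral>t. (inverse ?X * sq_fun p q R w t) powr p \<partial>lborel)"
      unfolding z_def using X w
      by (subst f_norm_restr_powr) (auto simp: R sq_fun_mult less_imp_le)
    also have "\<dots> = inverse ?X powr p * ?X powr p"
      using X f_norm_restr_powr[where ?'k = 'k, OF R, of w] w
      by (simp add: powr_mult sq_fun_nonneg less_imp_le)
    also have "\<dots> = 1"
      using X by (simp flip: powr_mult)
    finally have "f_norm p q z \<le> 1"
      using powr_less_mono2[of p 1 "f_norm p q z"] by (cases "f_norm p q z \<le> 1") auto
    moreover have "z \<in> f_space p q"
      unfolding z_def by (intro restr_in_f_space R)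
    moreover have "norm (?F z) = 1"
      using X by (simp add: z scale norming_fun_self norm_mult norm_inverse)
    ultimately show "1 \<in> (\<lambda>x. norm (?F x)) ` {x \<in> f_space p q. f_norm p q x \<le> 1}"
      by (intro image_eqI[of _ _ z]) auto
  qed (auto intro!: norm_norming_fun_le_1 assms)
  then show ?thesis
    using bounded norming_fun_self by (simp add: norming_functional_def)
qed

text \<open>On basis vectors the functional is a fixed multiple of the coefficient inside
  \<open>R\<close> and 0 outside. A largest coefficient is thus an admissible choice for every
  weakness parameter up to 1.\<close>

lemma norming_fun_greedy:
  assumes I: "I \<in> R" "\<And>J. J \<in> R \<Longrightarrow> norming_coeff p q R w J \<le> norming_coeff p q R w I"
    and "\<tau> \<ge> 0" "\<tau> \<le> 1"
  shows "\<tau> * (SUP g\<in>canonical_basis. norm (norming_fun p q R w g :: 'k))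
     \<le> norm (norming_fun p q R w (unit_seq I) :: 'k::real_normed_field)"
proof -
  have "(SUP g\<in>canonical_basis. norm (norming_fun p q R w g :: 'k))
      \<le> norm (norming_fun p q R w (unit_seq I) :: 'k)"
  proof (rule cSUP_least)
    show "canonical_basis \<noteq> ({} :: ((real ^ 'd) set \<Rightarrow> 'k) set)"
      using I(1) R by (auto simp: canonical_basis_def)
    fix g :: "(real ^ 'd) set \<Rightarrow> 'k" assume "g \<in> canonical_basis"
    then show "norm (norming_fun p q R w g) \<le> norm (norming_fun p q R w (unit_seq I) :: 'k)"
      using I R
      by (auto simp: canonical_basis_def norming_fun_unit_seq norm_mult norming_coeff_nonneg
          intro!: mult_left_mono)
  qed
  then have "\<tau> * (SUP g\<in>canonical_basis. norm (norming_fun p q R w g :: 'k))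
      \<le> \<tau> * norm (norming_fun p q R w (unit_seq I) :: 'k)"
    using assms by (intro mult_left_mono) auto
  also have "\<dots> \<le> norm (norming_fun p q R w (unit_seq I) :: 'k)"
    using assms by (intro mult_left_le_one_le) auto
  finally show ?thesis .
qed

end

section \<open>Admissible runs that delete one coordinate at a time\<close>

text \<open>Since the norm is a lattice norm, truncation is a best approximation.\<close>

lemma f_norm_truncate:
  fixes T :: "(real ^ 'd) set set"
  assumes T: "finite T" "T \<subseteq> dyadic_rects" and E: "E \<subseteq> T"
  shows "f_norm p q (restr T w - restr E w :: _ \<Rightarrow> 'k::real_normed_field)
     = dist_to (f_norm p q) (restr T w :: _ \<Rightarrow> 'k) (fun_vs.span (unit_seq ` E))"
  unfolding dist_to_def
proof (rule antisym)
  have inE: "restr E w \<in> fun_vs.span (unit_seq ` E :: (_ \<Rightarrow> 'k) set)"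
    using finite_subset[OF E T(1)] by (rule restr_in_span)
  show "f_norm p q (restr T w - restr E w :: _ \<Rightarrow> 'k)
      \<le> (INF a\<in>fun_vs.span (unit_seq ` E :: (_ \<Rightarrow> 'k) set). f_norm p q (restr T w - a))"
  proof (rule cINF_greatest)
    fix a :: "(real ^ 'd) set \<Rightarrow> 'k" assume a: "a \<in> fun_vs.span (unit_seq ` E)"
    note a0 = span_unit_seq_outside[OF a]
    show "f_norm p q (restr T w - restr E w :: _ \<Rightarrow> 'k) \<le> f_norm p q (restr T w - a)"
    proof (rule f_norm_mono)
      \<comment> \<open>On \<open>E\<close> the left side is 0; off \<open>E\<close> the vector
        \<open>a\<close> vanishes and the two sides agree.\<close>
      show "norm ((restr T w - restr E w :: _ \<Rightarrow> 'k) I) \<le> norm ((restr T w - a) I)" for I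
        using a0[of I] E by (cases "I \<in> E"; cases "I \<in> T") (simp_all add: restr_def subset_iff)
      show "restr T w - a \<in> f_space p q"
      proof (rule finite_support_in_f_space[OF T])
        show "(restr T w - a) I = 0" if "I \<notin> T" for I
          using that E a0[of I] by (auto simp: restr_def)
      qed simp_all
    qed simp_all
  qed (use inE in blast)
  show "(INF a\<in>fun_vs.span (unit_seq ` E :: (_ \<Rightarrow> 'k) set). f_norm p q (restr T w - a))
      \<le> f_norm p q (restr T w - restr E w :: _ \<Rightarrow> 'k)"
  proof (rule cINF_lower)
    show "bdd_below ((\<lambda>a. f_norm p q (restr T w - a)) ` fun_vs.span (unit_seq ` E :: (_ \<Rightarrow> 'k) set))"
      by (rule bdd_belowI2[of _ 0]) (rule f_norm_nonneg)
  qed (rule inE)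
qed

text \<open>Best approximations being truncations, every remainder is again a restriction of
  \<open>w\<close>, so a run amounts to deleting maximisers from an index set. The freedom of
  \<open>pick\<close> among several maximisers is what allows the run to be steered later.\<close>

lemma wcga_run_truncations:
  fixes T :: "(real ^ 'd) set set" and pick :: "(real ^ 'd) set set \<Rightarrow> (real ^ 'd) set"
  assumes T: "finite T" "T \<subseteq> dyadic_rects" and w: "\<And>I. I \<in> T \<Longrightarrow> w I > 0"
    and pick: "\<And>R. R \<subseteq> T \<Longrightarrow> R \<noteq> {} \<Longrightarrow> pick R \<in> R"
      "\<And>R J. R \<subseteq> T \<Longrightarrow> J \<in> R \<Longrightarrow> norming_coeff p q R w J \<le> norming_coeff p q R w (pick R)"
    and \<tau>: "0 \<le> \<tau>" "\<tau> \<le> 1"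
    and rest: "rest 0 = T" "\<And>n. rest (Suc n) = rest n - {pick (rest n)}"
  shows "wcga_run (f_space p q) (f_norm p q) canonical_basis \<tau>
    (restr T w :: _ \<Rightarrow> 'k::real_normed_field)
    (\<lambda>n. unit_seq (pick (rest (n - 1)))) (\<lambda>n. restr (T - rest n) w)"
proof -
  \<comment> \<open>Step n + 1 selects from the index set left after n steps, hence the
    shift.\<close>
  define \<phi> where "\<phi> = (\<lambda>n. unit_seq (pick (rest (n - 1))) :: (real ^ 'd) set \<Rightarrow> 'k)"
  have sub: "rest n \<subseteq> T" for n
    by (induction n) (auto simp: rest)
  have diff: "restr T w - restr (T - rest n) w = (restr (rest n) w :: _ \<Rightarrow> 'k)" for n
    using sub[of n] by (simp add: restr_minus_restr double_diff)
  have zero: "restr (rest n) w = (0 :: _ \<Rightarrow> 'k) \<longleftrightarrow> rest n = {}" for n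
  proof -
    have "w I \<noteq> 0" if "I \<in> rest n" for I
      using w[of I] sub[of n] that by auto
    then show ?thesis
      by (auto simp: restr_def fun_eq_iff)
  qed
  \<comment> \<open>Once the index set is exhausted, \<open>pick\<close> is unconstrained and may
    return anything; hence the condition.\<close>
  have picked: "T - rest (Suc n) = (\<lambda>m. pick (rest m)) ` {..n}" if "rest n \<noteq> {}" for n
    using that
  proof (induction n)
    case 0
    then show ?case using pick(1)[of T] by (auto simp: rest)
  next
    case (Suc n)
    then have "rest n \<noteq> {}" by (auto simp: rest)
    then have "T - rest (Suc n) = (\<lambda>m. pick (rest m)) ` {..n}"
      by (rule Suc.IH)
    moreover have "pick (rest (Suc n)) \<in> T"
      using pick(1)[OF sub Suc.prems] sub by blast
    then have "T - rest (Suc (Suc n)) = insert (pick (rest (Suc n))) (T - rest (Suc n))"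
      by (subst rest) auto
    ultimately show ?case
      by (simp add: atMost_Suc)
  qed
  have "{1..Suc n} = Suc ` {..n}" for n
    by (simp add: image_Suc_atMost)
  then have chosen: "\<phi> ` {1..Suc n} = unit_seq ` (T - rest (Suc n))" if "rest n \<noteq> {}" for n
    unfolding \<phi>_def picked[OF that] by (simp only: image_image diff_Suc_1)
  have step: "\<phi> (Suc n) \<in> canonical_basis \<and>
       (\<exists>F. norming_functional (f_space p q) (f_norm p q) (restr (rest n) w) F \<and>
            norm (F (\<phi> (Suc n))) \<ge> \<tau> * (SUP g\<in>canonical_basis. norm (F g))) \<and>
       restr (T - rest (Suc n)) w \<in> fun_vs.span (\<phi> ` {1..Suc n}) \<and>
       f_norm p q (restr T w - restr (T - rest (Suc n)) w :: _ \<Rightarrow> 'k)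
         = dist_to (f_norm p q) (restr T w) (fun_vs.span (\<phi> ` {1..Suc n}))"
    if ne: "rest n \<noteq> {}" for n
  proof (intro conjI exI)
    have R: "finite (rest n)" "rest n \<subseteq> dyadic_rects" "\<And>I. I \<in> rest n \<Longrightarrow> w I > 0"
      using sub[of n] T w finite_subset by auto
    have "pick (rest n) \<in> rest n" "\<And>J. J \<in> rest n \<Longrightarrow>
        norming_coeff p q (rest n) w J \<le> norming_coeff p q (rest n) w (pick (rest n))"
      using pick sub ne by auto
    note P = this
    show "\<phi> (Suc n) \<in> canonical_basis"
      using P(1) R(2) by (auto simp: \<phi>_def canonical_basis_def)
    show "norming_functional (f_space p q) (f_norm p q) (restr (rest n) w)
        (norming_fun p q (rest n) w :: (_ \<Rightarrow> 'k) \<Rightarrow> 'k)"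
      using R ne by (rule norming_functional_norming_fun)
    show "\<tau> * (SUP g\<in>canonical_basis. norm (norming_fun p q (rest n) w g :: 'k))
       \<le> norm (norming_fun p q (rest n) w (\<phi> (Suc n)))"
      unfolding \<phi>_def using R P \<tau> by (simp add: norming_fun_greedy)
    show "restr (T - rest (Suc n)) w \<in> fun_vs.span (\<phi> ` {1..Suc n})"
      unfolding chosen[OF ne] using T by (intro restr_in_span) auto
    show "f_norm p q (restr T w - restr (T - rest (Suc n)) w :: _ \<Rightarrow> 'k)
         = dist_to (f_norm p q) (restr T w) (fun_vs.span (\<phi> ` {1..Suc n}))"
      unfolding chosen[OF ne] using T by (intro f_norm_truncate) auto
  qed
  show ?thesis
    unfolding wcga_run_def \<phi>_def[symmetric] diff zero
  proof (intro conjI allI)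
    show "restr (T - rest 0) w = (0 :: _ \<Rightarrow> 'k)"
      by (simp add: rest)
    fix n
    show "if rest n = {} then restr (T - rest (Suc n)) w = (restr (T - rest n) w :: _ \<Rightarrow> 'k)
      else \<phi> (Suc n) \<in> canonical_basis \<and>
       (\<exists>F. norming_functional (f_space p q) (f_norm p q) (restr (rest n) w) F \<and>
            norm (F (\<phi> (Suc n))) \<ge> \<tau> * (SUP g\<in>canonical_basis. norm (F g))) \<and>
       restr (T - rest (Suc n)) w \<in> fun_vs.span (\<phi> ` {1..Suc n}) \<and>
       f_norm p q (restr (rest (Suc n)) w :: _ \<Rightarrow> 'k)
         = dist_to (f_norm p q) (restr T w) (fun_vs.span (\<phi> ` {1..Suc n}))"
      using step[of n] unfolding diff by (simp add: rest)
  qed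
qed

end

section \<open>Disjoint and overlapping families\<close>

lemma sq_fun_isolated:
  assumes "finite R" "I \<in> R" "\<And>J. J \<in> R \<Longrightarrow> J \<noteq> I \<Longrightarrow> t \<notin> J" "w I \<ge> 0" "q > 0"
  shows "sq_fun p q R w t = w I * normalized_indicator p I t"
proof -
  have "(\<Sum>J\<in>R. (w J * normalized_indicator p J t) powr q)
      = (\<Sum>J\<in>{I}. (w J * normalized_indicator p J t) powr q)"
    using assms by (intro sum.mono_neutral_right) (auto simp: normalized_indicator_def)
  then show ?thesis
    using assms by (simp add: sq_fun_def powr_powr normalized_indicator_nonneg)
qed

text \<open>The rectangles of \<open>B\<close> through \<open>t\<close> contribute equally, and
  further members of \<open>R\<close> only increase the sum. The bound therefore holds for every
  finite family that still contains all of \<open>B\<close>.\<close>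

lemma sq_fun_ge_overlap:
  assumes R: "finite R" "B \<subseteq> R" and q: "q > 0" and w: "\<And>I. I \<in> B \<Longrightarrow> w I = 1"
    and m: "\<And>I. I \<in> B \<Longrightarrow> measure lborel I = m"
    and K: "K \<le> real (card {I \<in> B. t \<in> I})" "K \<ge> 0"
  shows "K powr (1 / q) * m powr (- 1 / p) \<le> sq_fun p q R w t"
proof -
  let ?B = "{I \<in> B. t \<in> I}"
  have "K * (m powr (- 1 / p)) powr q \<le> (\<Sum>I\<in>?B. (m powr (- 1 / p)) powr q)"
    using K by (simp add: mult_right_mono)
  also have "\<dots> = (\<Sum>I\<in>?B. (w I * normalized_indicator p I t) powr q)"
    using w m by (intro sum.cong) (auto simp: normalized_indicator_def)
  also have "\<dots> \<le> (\<Sum>I\<in>R. (w I * normalized_indicator p I t) powr q)"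
    using R by (intro sum_mono2) auto
  finally have "(K * (m powr (- 1 / p)) powr q) powr (1 / q) \<le> sq_fun p q R w t"
    unfolding sq_fun_def using q K by (intro powr_mono2) auto
  then show ?thesis
    using q K by (simp add: powr_mult powr_powr)
qed

context mixed_exponents
begin

text \<open>On \<open>I\<close> the square function consists of the term of \<open>I\<close> alone,
  so q cancels and the normalisation of the indicator removes the volume. The value does not depend
  on the rest of the family.\<close>

lemma norming_coeff_isolated:
  fixes R :: "(real ^ 'd) set set"
  assumes R: "finite R" and I: "I \<in> R" "I \<in> dyadic_rects" and w: "w I > 0"
    and disj: "\<And>J. J \<in> R \<Longrightarrow> J \<noteq> I \<Longrightarrow> J \<inter> I = {}"
  shows "norming_coeff p q R w I = w I powr (p - 1)"
proof -
  define m where "m = measure lborel I"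
  define c where "c = m powr (- 1 / p)"
  have m: "m > 0"
    unfolding m_def using I(2) by (rule measure_dyadic_rects_pos)
  then have c: "c > 0" by (simp add: c_def)
  have "(w I * normalized_indicator p I t) powr (q - 1) * normalized_indicator p I t
      * sq_fun p q R w t powr (p - q) = w I powr (p - 1) * c powr p * indicator I t" for t
  proof (cases "t \<in> I")
    case True
    then have n: "normalized_indicator p I t = c"
      by (simp add: normalized_indicator_def c_def m_def)
    have "sq_fun p q R w t = w I * c"
      using sq_fun_isolated[OF R I(1), of t w q p] disj True w n by auto
    then have "(w I * normalized_indicator p I t) powr (q - 1) * normalized_indicator p I t
      * sq_fun p q R w t powr (p - q) = (w I * c) powr (p - 1) * c"
      unfolding n by (simp add: mult_ac flip: powr_add)
    also have "\<dots> = w I powr (p - 1) * c powr p"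
      using w c by (simp add: powr_mult powr_diff)
    finally show ?thesis using True by simp
  qed (simp add: normalized_indicator_def)
  then have "norming_coeff p q R w I = w I powr (p - 1) * c powr p * m"
    unfolding norming_coeff_def m_def by simp
  also have "\<dots> = w I powr (p - 1) * (c powr p * m)"
    by simp
  also have "c powr p * m = 1"
    using m by (simp add: c_def powr_powr powr_minus_divide powr_divide)
  finally show ?thesis by simp
qed

text \<open>The exponent \<open>p - q\<close> is at most 0, so a large square function makes the
  coefficient small: the factor K^(1/q) enters with power p - q.\<close>

lemma norming_coeff_le:
  fixes R :: "(real ^ 'd) set set"
  assumes R: "finite R" "R \<subseteq> dyadic_rects" and I: "I \<in> R" and w: "\<And>I. I \<in> R \<Longrightarrow> w I > 0" "w I = 1"
    and K: "K > 0"
    and S: "\<And>t. t \<in> I \<Longrightarrow> K powr (1 / q) * measure lborel I powr (- 1 / p) \<le> sq_fun p q R w t"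
  shows "norming_coeff p q R w I \<le> K powr (p / q - 1)"
proof -
  define m where "m = measure lborel I"
  define c where "c = m powr (- 1 / p)"
  have I': "I \<in> dyadic_rects" using I R by auto
  then have m: "m > 0"
    unfolding m_def by (rule measure_dyadic_rects_pos)
  then have c: "c > 0" by (simp add: c_def)
  have le: "(w I * normalized_indicator p I t) powr (q - 1) * normalized_indicator p I t
      * sq_fun p q R w t powr (p - q) \<le> K powr (p / q - 1) * c powr p * indicator I t" for t
  proof (cases "t \<in> I")
    case True
    then have n: "normalized_indicator p I t = c"
      by (simp add: normalized_indicator_def c_def m_def)
    have "sq_fun p q R w t powr (p - q) \<le> (K powr (1 / q) * c) powr (p - q)"
      using S[OF True] K c p_le_q by (intro powr_mono2') (auto simp: c_def m_def)
    then have "(w I * normalized_indicator p I t) powr (q - 1) * normalized_indicator p I t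
      * sq_fun p q R w t powr (p - q) \<le> c powr (q - 1) * c * (K powr (1 / q) * c) powr (p - q)"
      unfolding n w(2) using c by (simp add: mult_left_mono)
    also have "\<dots> = K powr ((p - q) / q) * (c powr (q - 1) * c powr 1 * c powr (p - q))"
      using K c by (simp add: powr_mult powr_powr)
    also have "\<dots> = K powr (p / q - 1) * c powr p"
      unfolding powr_add[symmetric] by (simp add: diff_divide_distrib)
    finally show ?thesis using True by simp
  qed (simp add: normalized_indicator_def)
  have "norming_coeff p q R w I \<le> (\<integral>t. K powr (p / q - 1) * c powr p * indicator I t \<partial>lborel)"
    unfolding norming_coeff_def using le I' emeasure_dyadic_rects[OF I']
    by (intro integral_mono integrable_norming_coeff R w I) auto
  also have "\<dots> = K powr (p / q - 1) * (c powr p * m)"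
    by (simp add: m_def)
  also have "c powr p * m = 1"
    using m by (simp add: c_def powr_powr powr_minus_divide powr_divide)
  finally show ?thesis by simp
qed

text \<open>At most one indicator is nonzero at each point, so the norm reduces to an ell^p norm
  independently of q.\<close>

lemma f_norm_restr_disjoint:
  fixes A :: "(real ^ 'd) set set"
  assumes A: "finite A" "A \<subseteq> dyadic_rects" "disjoint A" and "a \<ge> 0"
  shows "f_norm p q (restr A (\<lambda>_. a) :: _ \<Rightarrow> 'k::real_normed_field) powr p = real (card A) * a powr p"
proof -
  have pw: "sq_fun p q A (\<lambda>_. a) t powr p = (\<Sum>I\<in>A. a powr p / measure lborel I * indicator I t)" for t
  proof (cases "\<exists>I\<in>A. t \<in> I")
    case True
    then obtain I where I: "I \<in> A" "t \<in> I" by auto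
    have other: "t \<notin> J" if "J \<in> A" "J \<noteq> I" for J
      using that I A(3) by (auto simp: disjoint_def)
    have m: "measure lborel I > 0"
      using I A by (intro measure_dyadic_rects_pos) auto
    have "sq_fun p q A (\<lambda>_. a) t = a * normalized_indicator p I t"
      using assms I other by (intro sq_fun_isolated) auto
    moreover have "(\<Sum>J\<in>A. a powr p / measure lborel J * indicator J t)
        = (\<Sum>J\<in>{I}. a powr p / measure lborel J * indicator J t)"
      using A(1) I other by (intro sum.mono_neutral_right) auto
    ultimately show ?thesis
      using I m assms(4) by (simp add: normalized_indicator_def powr_mult powr_powr powr_minus_divide powr_divide)
  next
    case False
    then show ?thesis
      by (simp add: sq_fun_def normalized_indicator_def)
  qed
  have "f_norm p q (restr A (\<lambda>_. a) :: _ \<Rightarrow> 'k) powr p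
      = (\<integral>t. (\<Sum>I\<in>A. a powr p / measure lborel I * indicator I t) \<partial>lborel)"
    using assms by (simp add: f_norm_restr_powr pw)
  also have "\<dots> = (\<Sum>I\<in>A. a powr p)"
  proof (subst Bochner_Integration.integral_sum)
    fix I assume "I \<in> A"
    then have I: "I \<in> dyadic_rects" using A by auto
    then show "integrable lborel (\<lambda>t. a powr p / measure lborel I * indicator I t)"
      using emeasure_dyadic_rects[OF I] by simp
  next
    have "measure lborel I \<noteq> 0" if "I \<in> A" for I
      using that A measure_dyadic_rects_pos[of I] by auto
    then show "(\<Sum>I\<in>A. \<integral>t. a powr p / measure lborel I * indicator I t \<partial>lborel) = (\<Sum>I\<in>A. a powr p)"
      by (intro sum.cong) auto
  qed
  finally show ?thesis by simp
qed

text \<open>This integrates the pointwise bound of \<open>sq_fun_ge_overlap\<close> over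
  \<open>H\<close>.\<close>

lemma f_norm_restr_overlap:
  fixes B :: "(real ^ 'd) set set"
  assumes B: "finite B" "B \<subseteq> dyadic_rects" and m: "\<And>I. I \<in> B \<Longrightarrow> measure lborel I = m" "m > 0"
    and K: "\<And>t. t \<in> H \<Longrightarrow> K \<le> real (card {I \<in> B. t \<in> I})" "K > 0"
    and H: "H \<in> dyadic_rects"
  shows "K powr (p / q) / m * measure lborel H
    \<le> f_norm p q (restr B (\<lambda>_. 1) :: _ \<Rightarrow> 'k::real_normed_field) powr p"
proof -
  have le: "K powr (p / q) / m * indicator H t \<le> sq_fun p q B (\<lambda>_. 1) t powr p" for t
  proof (cases "t \<in> H")
    case True
    have "K powr (1 / q) * m powr (- 1 / p) \<le> sq_fun p q B (\<lambda>_. 1) t"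
      using B m K True by (intro sq_fun_ge_overlap[of _ B]) auto
    then have "(K powr (1 / q) * m powr (- 1 / p)) powr p \<le> sq_fun p q B (\<lambda>_. 1) t powr p"
      by (intro powr_mono2) auto
    then show ?thesis
      using True m K by (simp add: powr_mult powr_powr powr_minus_divide powr_divide)
  qed simp
  have "(\<integral>t. K powr (p / q) / m * indicator H t \<partial>lborel) \<le> (\<integral>t. sq_fun p q B (\<lambda>_. 1) t powr p \<partial>lborel)"
    using le H emeasure_dyadic_rects[OF H] B by (intro integral_mono integrable_sq_fun) auto
  then show ?thesis
    using B by (simp add: f_norm_restr_powr)
qed

end

section \<open>The two test families: disjoint strips and overlapping blocks\<close>

text \<open>The strips lie in the half \<open>t $ e \<ge> 1 / 2\<close> of the cube and the blocks in the half
  \<open>t $ e < 1 / 2\<close>. The shape of a block is free in all directions but \<open>e\<close>, where it is adjusted so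
  that all blocks have the same volume; thus every point is covered once per shape.\<close>

definition strips :: "'d::finite \<Rightarrow> nat \<Rightarrow> (real ^ 'd) set set" where
  "strips e M = (\<lambda>s. dyadic_rect (\<lambda>i. if i = e then Suc M else 0) (\<lambda>i. if i = e then 2 ^ M + s else 0)) ` {..<M}"

definition shapes :: "'d::finite \<Rightarrow> nat \<Rightarrow> ('d \<Rightarrow> nat) set" where
  "shapes e r = {j. (\<forall>i. i \<noteq> e \<longrightarrow> j i \<le> r) \<and> (\<Sum>i\<in>UNIV. j i) = Suc (CARD('d) * r)}"

definition blocks :: "'d::finite \<Rightarrow> nat \<Rightarrow> (real ^ 'd) set set" where
  "blocks e r = (\<Union>j\<in>shapes e r. dyadic_rect j ` (\<Pi>\<^sub>E i\<in>UNIV. {..<2 ^ (j i - of_bool (i = e))}))"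

definition lower_half :: "'d::finite \<Rightarrow> (real ^ 'd) set" where
  "lower_half e = dyadic_rect (\<lambda>i. of_bool (i = e)) (\<lambda>_. 0)"

text \<open>Every point of a strip determines the index of the strip, which yields both disjointness
  and the count.\<close>

lemma strip_coordinate:
  assumes "t \<in> dyadic_rect (\<lambda>i. if i = e then Suc M else 0) (\<lambda>i. if i = e then 2 ^ M + s else 0)"
  shows "\<lfloor>t $ e * 2 ^ Suc M\<rfloor> = 2 ^ M + int s" "t $ e \<ge> 1 / 2"
proof -
  have t: "(2 ^ M + real s) / 2 ^ Suc M \<le> t $ e" "t $ e < (2 ^ M + real s + 1) / 2 ^ Suc M"
    using assms by (auto simp: dyadic_rect_def dest: spec[of _ e])
  then show "\<lfloor>t $ e * 2 ^ Suc M\<rfloor> = 2 ^ M + int s"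
    by (intro floor_unique) (auto simp: field_simps)
  have "1 / 2 = (2 :: real) ^ M / 2 ^ Suc M" by simp
  also have "\<dots> \<le> (2 ^ M + real s) / 2 ^ Suc M"
    by (intro divide_right_mono) auto
  finally show "t $ e \<ge> 1 / 2" using t by linarith
qed

lemma strips_upper: "(I :: (real ^ 'd) set) \<in> strips e M \<Longrightarrow> t \<in> I \<Longrightarrow> t $ e \<ge> 1 / 2"
  unfolding strips_def using strip_coordinate(2) by blast

lemma finite_strips [simp]: "finite (strips e M)"
  by (simp add: strips_def)

text \<open>As M < 2^M, level M + 1 has room for M strips in the upper half, whatever M is.\<close>

lemma strips_dyadic: "strips e M \<subseteq> dyadic_rects"
proof -
  have "2 ^ M + s < 2 ^ Suc M" if "s < M" for s :: nat
    using less_trans[OF that less_exp] by simp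
  then show ?thesis
    unfolding strips_def by (auto intro!: dyadic_rect_in_dyadic_rects)
qed

lemma disjoint_strips: "disjoint (strips e M :: (real ^ 'd) set set)"
proof (rule disjointI)
  fix I J :: "(real ^ 'd) set" assume "I \<in> strips e M" "J \<in> strips e M" "I \<noteq> J"
  then obtain s s' where s: "I = dyadic_rect (\<lambda>i. if i = e then Suc M else 0) (\<lambda>i. if i = e then 2 ^ M + s else 0)"
      "J = dyadic_rect (\<lambda>i. if i = e then Suc M else 0) (\<lambda>i. if i = e then 2 ^ M + s' else 0)" "s \<noteq> s'"
    unfolding strips_def by blast
  show "I \<inter> J = {}"
  proof (rule equals0I)
    fix t assume "t \<in> I \<inter> J"
    then have "2 ^ M + int s = 2 ^ M + int s'"
      using strip_coordinate(1)[of t e M s] strip_coordinate(1)[of t e M s'] unfolding s by simp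
    with s(3) show False by simp
  qed
qed

lemma card_strips: "card (strips e M) = M"
proof -
  have "inj_on (\<lambda>s. dyadic_rect (\<lambda>i. if i = e then Suc M else 0) (\<lambda>i. if i = e then 2 ^ M + s else 0)) {..<M}"
  proof (rule inj_onI)
    fix s s'
    let ?I = "\<lambda>s. dyadic_rect (\<lambda>i. if i = e then Suc M else 0) (\<lambda>i. if i = e then 2 ^ M + s else 0)"
    assume "?I s = ?I s'"
    then obtain t where "t \<in> ?I s" "t \<in> ?I s'"
      using dyadic_rect_corner by blast
    then have "2 ^ M + int s = 2 ^ M + int s'"
      using strip_coordinate(1) by metis
    then show "s = s'" by simp
  qed
  then show ?thesis
    by (simp add: strips_def card_image)
qed

lemma sum_shape_le:
  fixes e :: "'d::finite"
  assumes "\<And>i. i \<noteq> e \<Longrightarrow> j i \<le> r"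
  shows "(\<Sum>i\<in>-{e}. j i) \<le> CARD('d) * r"
proof -
  have "(\<Sum>i\<in>-{e}. j i) \<le> (\<Sum>i\<in>-{e}. r)"
    using assms by (intro sum_mono) auto
  also have "\<dots> \<le> CARD('d) * r"
    by (simp add: card_mono)
  finally show ?thesis .
qed

lemma sum_split: "(\<Sum>i\<in>UNIV. j i) = j e + (\<Sum>i\<in>-{e}. j i)" for e :: "'d::finite"
  by (subst sum.remove[of _ e]) (auto simp: Compl_eq_Diff_UNIV)

text \<open>The other coordinates sum to at most d * r, and the total is one larger. This extra unit
  makes every shape fine enough in direction \<open>e\<close> to tile the half cube.\<close>

lemma shape_pos: "j \<in> shapes e r \<Longrightarrow> j e \<ge> 1"
  using sum_shape_le[of e j r] sum_split[of j e] by (auto simp: shapes_def)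

text \<open>The coordinates off \<open>e\<close> are free in {0..r}, and the prescribed total
  determines the one at \<open>e\<close>; by \<open>sum_shape_le\<close> the subtraction is never
  truncated.\<close>

lemma card_shapes: "card (shapes e r) = Suc r ^ (CARD('d) - 1)" for e :: "'d::finite"
proof -
  have "bij_betw (\<lambda>j. restrict j (-{e})) (shapes e r) (\<Pi>\<^sub>E i\<in>-{e}. {..r})"
  proof (rule bij_betw_byWitness[where f' = "\<lambda>h. h(e := Suc (CARD('d) * r) - (\<Sum>i\<in>-{e}. h i))"])
    show "\<forall>j\<in>shapes e r. (restrict j (-{e}))(e := Suc (CARD('d) * r) - (\<Sum>i\<in>-{e}. restrict j (-{e}) i)) = j"
    proof
      fix j assume j: "j \<in> shapes e r"
      have "Suc (CARD('d) * r) - (\<Sum>i\<in>-{e}. restrict j (-{e}) i) = j e"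
        using j sum_split[of j e] by (auto simp: shapes_def)
      then show "(restrict j (-{e}))(e := Suc (CARD('d) * r) - (\<Sum>i\<in>-{e}. restrict j (-{e}) i)) = j"
        by (auto simp: fun_eq_iff)
    qed
    show "\<forall>h\<in>\<Pi>\<^sub>E i\<in>-{e}. {..r}. restrict (h(e := Suc (CARD('d) * r) - (\<Sum>i\<in>-{e}. h i))) (-{e}) = h"
      by (auto simp: fun_eq_iff PiE_iff extensional_def)
    show "(\<lambda>j. restrict j (-{e})) ` shapes e r \<subseteq> (\<Pi>\<^sub>E i\<in>-{e}. {..r})"
      by (auto simp: shapes_def PiE_iff split: if_splits)
    show "(\<lambda>h. h(e := Suc (CARD('d) * r) - (\<Sum>i\<in>-{e}. h i))) ` (\<Pi>\<^sub>E i\<in>-{e}. {..r}) \<subseteq> shapes e r"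
    proof clarify
      fix h :: "'d \<Rightarrow> nat" assume h: "h \<in> (\<Pi>\<^sub>E i\<in>-{e}. {..r})"
      let ?j = "h(e := Suc (CARD('d) * r) - (\<Sum>i\<in>-{e}. h i))"
      have eq: "(\<Sum>i\<in>-{e}. ?j i) = (\<Sum>i\<in>-{e}. h i)"
        by (intro sum.cong) auto
      have "(\<Sum>i\<in>-{e}. h i) \<le> CARD('d) * r"
        using h by (intro sum_shape_le) (auto simp: PiE_iff)
      then have "(\<Sum>i\<in>UNIV. ?j i) = Suc (CARD('d) * r)"
        unfolding sum_split[of ?j e] eq by simp
      then show "?j \<in> shapes e r"
        using h unfolding shapes_def by (simp add: PiE_iff)
    qed
  qed
  then have "card (shapes e r) = card (\<Pi>\<^sub>E i\<in>-{e}. {..r})"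
    by (rule bij_betw_same_card)
  also have "\<dots> = Suc r ^ (CARD('d) - 1)"
    by (simp add: card_PiE Compl_eq_Diff_UNIV)
  finally show ?thesis .
qed

text \<open>An infinite set would have cardinality 0, but the count is positive.\<close>

lemma finite_shapes [simp]: "finite (shapes e r)"
  using card_shapes[of e r] card.infinite by fastforce

lemma finite_blocks [simp]: "finite (blocks e r)"
  by (auto simp: blocks_def intro!: finite_PiE)

lemma card_blocks_le: "card (blocks e r) \<le> Suc r ^ (CARD('d) - 1) * 2 ^ (CARD('d) * r)"
  for e :: "'d::finite"
proof -
  have "card (dyadic_rect j ` (\<Pi>\<^sub>E i\<in>UNIV. {..<2 ^ (j i - of_bool (i = e))})) \<le> 2 ^ (CARD('d) * r)"
    if j: "j \<in> shapes e r" for j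
  proof -
    \<comment> \<open>Natural subtraction is exact here because \<open>j e\<close> is at least
      1.\<close>
    have "(\<Sum>i\<in>UNIV. j i) = (\<Sum>i\<in>UNIV. (j i - of_bool (i = e)) + of_bool (i = e))"
      using shape_pos[OF j] by (intro sum.cong) auto
    also have "\<dots> = (\<Sum>i\<in>UNIV. j i - of_bool (i = e)) + 1"
      by (simp add: sum.distrib of_bool_def)
    finally have s: "(\<Sum>i\<in>UNIV. j i - of_bool (i = e)) = CARD('d) * r"
      using j by (simp add: shapes_def)
    have "card (\<Pi>\<^sub>E i\<in>UNIV. {..<2 ^ (j i - of_bool (i = e)) :: nat}) = 2 ^ (CARD('d) * r)"
      by (simp add: card_PiE s flip: power_sum)
    then show ?thesis
      using card_image_le[of "\<Pi>\<^sub>E i\<in>UNIV. {..<2 ^ (j i - of_bool (i = e)) :: nat}" "dyadic_rect j"]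
      by (simp add: finite_PiE)
  qed
  then have "card (blocks e r) \<le> (\<Sum>j\<in>shapes e r. 2 ^ (CARD('d) * r))"
    unfolding blocks_def by (intro order_trans[OF card_UN_le] sum_mono) auto
  then show ?thesis
    by (simp add: card_shapes)
qed

lemma block_index_less:
  assumes "k \<in> (\<Pi>\<^sub>E i\<in>UNIV. {..<2 ^ (j i - of_bool (i = e))})"
  shows "k i < (2::nat) ^ j i"
proof -
  have "k i < 2 ^ (j i - of_bool (i = e))"
    using assms by (auto simp: PiE_iff)
  also have "\<dots> \<le> 2 ^ j i"
    by (intro power_increasing) auto
  finally show ?thesis .
qed

lemma blocks_dyadic: "blocks e r \<subseteq> dyadic_rects"
proof
  fix I assume "I \<in> blocks e r"
  then obtain j k where k: "k \<in> (\<Pi>\<^sub>E i\<in>UNIV. {..<2 ^ (j i - of_bool (i = e))})" and I: "I = dyadic_rect j k"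
    unfolding blocks_def by blast
  show "I \<in> dyadic_rects"
    unfolding I by (rule dyadic_rect_in_dyadic_rects) (rule block_index_less[OF k])
qed

lemma measure_blocks: "I \<in> blocks e r \<Longrightarrow> measure lborel I = 1 / 2 ^ Suc (CARD('d) * r)"
  for e :: "'d::finite"
  by (auto simp: blocks_def measure_dyadic_rect shapes_def)

lemma mem_lower_half: "t \<in> lower_half e \<longleftrightarrow> (\<forall>i. 0 \<le> t $ i \<and> t $ i < 1 / 2 ^ of_bool (i = e))"
  by (simp add: lower_half_def dyadic_rect_def)

lemma blocks_subset_lower_half:
  assumes "I \<in> blocks e r"
  shows "I \<subseteq> lower_half e"
proof
  fix t assume t: "t \<in> I"
  obtain j k where j: "j \<in> shapes e r" and k: "k \<in> (\<Pi>\<^sub>E i\<in>UNIV. {..<2 ^ (j i - of_bool (i = e))})"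
    and I: "I = dyadic_rect j k"
    using assms unfolding blocks_def by blast
  show "t \<in> lower_half e"
    unfolding mem_lower_half
  proof
    fix i
    have "of_bool (i = e) \<le> j i"
      using shape_pos[OF j] by auto
    then have pow: "(2::real) ^ j i = 2 ^ (j i - of_bool (i = e)) * 2 ^ of_bool (i = e)"
      by (simp flip: power_add)
    have "Suc (k i) \<le> 2 ^ (j i - of_bool (i = e))"
      using k by (auto simp: PiE_iff Suc_le_eq)
    then have "real (Suc (k i)) \<le> 2 ^ (j i - of_bool (i = e))"
      by (metis of_nat_le_iff of_nat_numeral of_nat_power)
    moreover have "x / (a * b) \<le> 1 / b" if "x \<le> a" "a > 0" "b > 0" for x a b :: real
      using that by (simp add: field_simps)
    ultimately have "(real (k i) + 1) / 2 ^ j i \<le> 1 / 2 ^ of_bool (i = e)"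
      unfolding pow by simp
    moreover have "real (k i) / 2 ^ j i \<le> t $ i" "t $ i < (real (k i) + 1) / 2 ^ j i"
      using t by (auto simp: I dyadic_rect_def)
    moreover have "0 \<le> real (k i) / 2 ^ j i" by simp
    ultimately show "0 \<le> t $ i \<and> t $ i < 1 / 2 ^ of_bool (i = e)" by linarith
  qed
qed

lemma blocks_cover:
  assumes t: "t \<in> lower_half e" and j: "j \<in> shapes e r"
  obtains k where "dyadic_rect j k \<in> blocks e r" "t \<in> dyadic_rect j k"
proof
  define k where "k = (\<lambda>i. nat \<lfloor>t $ i * 2 ^ j i\<rfloor>)"
  have t': "0 \<le> t $ i" "t $ i < 1 / 2 ^ of_bool (i = e)" for i
    using t by (auto simp: mem_lower_half)
  have k: "real (k i) = of_int \<lfloor>t $ i * 2 ^ j i\<rfloor>" for i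
    using t'(1)[of i] by (simp add: k_def)
  show "t \<in> dyadic_rect j k"
    unfolding dyadic_rect_def k by (auto simp: divide_le_eq less_divide_eq)
  have "k i < 2 ^ (j i - of_bool (i = e))" for i
  proof -
    have "of_bool (i = e) \<le> j i"
      using shape_pos[OF j] by auto
    then have pow: "(2::real) ^ j i = 2 ^ (j i - of_bool (i = e)) * 2 ^ of_bool (i = e)"
      by (simp flip: power_add)
    have le: "real (k i) \<le> t $ i * 2 ^ j i"
      unfolding k by simp
    have "x * (a * b) < a" if "x < 1 / b" "a > 0" "b > 0" for x a b :: real
      using that by (simp add: field_simps)
    from this[of "t $ i" "2 ^ of_bool (i = e)" "2 ^ (j i - of_bool (i = e))"]
    have "t $ i * 2 ^ j i < 2 ^ (j i - of_bool (i = e))"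
      unfolding pow using t'(2)[of i] by simp
    with le have "real (k i) < 2 ^ (j i - of_bool (i = e))"
      by linarith
    then show ?thesis
      by (metis of_nat_less_iff of_nat_numeral of_nat_power)
  qed
  then show "dyadic_rect j k \<in> blocks e r"
    using j by (auto simp: blocks_def)
qed

text \<open>Each shape supplies a block through \<open>t\<close>, and blocks of different shapes are
  different sets.\<close>

lemma blocks_overlap:
  fixes e :: "'d::finite"
  assumes t: "t \<in> lower_half e"
  shows "Suc r ^ (CARD('d) - 1) \<le> card {I \<in> blocks e r. t \<in> I}"
proof -
  have "\<forall>j\<in>shapes e r. \<exists>k. dyadic_rect j k \<in> blocks e r \<and> t \<in> dyadic_rect j k"
    by (blast elim: blocks_cover[OF t])
  then obtain k where k: "\<And>j. j \<in> shapes e r \<Longrightarrow> dyadic_rect j (k j) \<in> blocks e r \<and> t \<in> dyadic_rect j (k j)"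
    by metis
  have "inj_on (\<lambda>j. dyadic_rect j (k j)) (shapes e r)"
    by (intro inj_onI) (rule dyadic_rect_eq_imp_shape_eq)
  then have "card (shapes e r) \<le> card {I \<in> blocks e r. t \<in> I}"
    using k by (intro card_inj_on_le) auto
  then show ?thesis
    by (simp add: card_shapes)
qed

lemma lower_half_dyadic: "lower_half e \<in> dyadic_rects"
  unfolding lower_half_def by (rule dyadic_rect_in_dyadic_rects) simp

lemma measure_lower_half: "measure lborel (lower_half e) = 1 / 2"
  by (simp add: lower_half_def measure_dyadic_rect of_bool_def)

lemma strips_blocks_disjoint:
  fixes I J :: "(real ^ 'd) set"
  assumes "I \<in> strips e M" "J \<in> blocks e r"
  shows "I \<inter> J = {}"
proof (rule equals0I)
  fix t assume "t \<in> I \<inter> J"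
  then have "t $ e \<ge> 1 / 2" "t \<in> lower_half e"
    using strips_upper[OF assms(1)] blocks_subset_lower_half[OF assms(2)] by auto
  then show False
    by (auto simp: mem_lower_half dest: spec[of _ e])
qed

section \<open>The lower bound\<close>

context mixed_exponents
begin

text \<open>A single instance of the hypothesis, with M steps against N terms. Only one run has to
  violate a smaller M, so the run may be chosen as unfavourably as ties permit.\<close>

lemma wcga_lower_bound:
  fixes e :: "'d::finite"
  assumes \<tau>: "0 \<le> \<tau>" "\<tau> \<le> 1" and C: "C > 0"
    and hyp: "\<And>x \<phi> G. x \<in> (f_space p q :: ((real ^ 'd) set \<Rightarrow> 'k::real_normed_field) set) \<Longrightarrow>
      wcga_run (f_space p q) (f_norm p q) canonical_basis \<tau> x \<phi> G \<Longrightarrow>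
      f_norm p q (x - G M) \<le> C * sigma_N (f_norm p q) canonical_basis N x"
    and N: "Suc r ^ (CARD('d) - 1) * 2 ^ (CARD('d) * r) \<le> N"
  shows "2 ^ (CARD('d) * r) * real (Suc r ^ (CARD('d) - 1)) powr (1 + (1 - p / q) / (p - 1))
    \<le> C powr p * real M"
proof -
  define K where "K = real (Suc r ^ (CARD('d) - 1))"
  \<comment> \<open>The exponent for which \<open>a powr (p - 1)\<close>, the coefficient on a
    strip, equals the bound \<open>K powr (p / q - 1)\<close> for the blocks.\<close>
  define \<theta> where "\<theta> = (1 - p / q) / (p - 1)"
  define a where "a = K powr (- \<theta>)"
  define A where "A = strips e M"
  define B where "B = blocks e r"
  define T where "T = A \<union> B"
  define w where "w = (\<lambda>I. if I \<in> A then a else 1)"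
  have K: "K > 0" by (simp add: K_def)
  then have a: "a > 0" by (simp add: a_def)
  have ap: "a powr (p - 1) = K powr (p / q - 1)"
    using p by (simp add: a_def powr_powr \<theta>_def)
  have A: "finite A" "A \<subseteq> dyadic_rects" and B: "finite B" "B \<subseteq> dyadic_rects"
    by (simp_all add: A_def B_def strips_dyadic blocks_dyadic)
  have T: "finite T" "T \<subseteq> dyadic_rects" and w: "w I > 0" for I
    using A B a by (auto simp: T_def w_def)
  have ne: "I \<noteq> {}" if "I \<in> dyadic_rects" for I :: "(real ^ 'd) set"
    using measure_dyadic_rects_pos[OF that] by auto
  have AB: "I \<inter> J = {}" if "I \<in> A" "J \<in> B" for I J
    using that strips_blocks_disjoint unfolding A_def B_def by blast
  \<comment> \<open>Disjointness as point sets gives disjoint families only because dyadic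
    rectangles are nonempty.\<close>
  have AB_disj: "A \<inter> B = {}"
  proof (rule equals0I)
    fix I assume "I \<in> A \<inter> B"
    then show False using AB[of I I] ne[of I] A by auto
  qed

  have coeff_A: "norming_coeff p q R w I = K powr (p / q - 1)" if "R \<subseteq> T" "I \<in> R" "I \<in> A" for R I
  proof -
    have "J \<inter> I = {}" if "J \<in> R" "J \<noteq> I" for J
      using that \<open>R \<subseteq> T\<close> \<open>I \<in> A\<close> AB[of I J] disjoint_strips[of e M]
      by (auto simp: T_def A_def disjoint_def)
    then show ?thesis
      using that T a A finite_subset[OF that(1)] unfolding ap[symmetric]
      by (subst norming_coeff_isolated) (auto simp: w_def)
  qed
  \<comment> \<open>Unlike the value on strips, this bound needs the whole of \<open>B\<close>,
    since removing blocks would lower the overlap.\<close>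
  have coeff_B: "norming_coeff p q R w I \<le> K powr (p / q - 1)" if "R \<subseteq> T" "B \<subseteq> R" "I \<in> B" for R I
  proof (rule norming_coeff_le)
    show "finite R" "R \<subseteq> dyadic_rects" "I \<in> R" "K > 0"
      using that T K finite_subset by auto
    have wB: "w J = 1" if "J \<in> B" for J
      using that AB_disj by (auto simp: w_def)
    then show "w I = 1" using that by simp
    fix t assume "t \<in> I"
    then have "t \<in> lower_half e"
      using blocks_subset_lower_half[of I e r] \<open>I \<in> B\<close> by (auto simp: B_def)
    then have "K \<le> real (card {I \<in> B. t \<in> I})"
      using blocks_overlap[of t e r] by (simp add: K_def B_def del: power_Suc of_nat_power)
    then show "K powr (1 / q) * measure lborel I powr (- 1 / p) \<le> sq_fun p q R w t"
      using \<open>finite R\<close> that K wB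
      by (intro sq_fun_ge_overlap[of _ B]) (auto simp: B_def measure_blocks)
  qed (rule w)

  \<comment> \<open>While all blocks and at least one strip remain, every strip is a maximiser, and
    the tie is broken in its favour. Otherwise any maximiser of the finite set will do.\<close>
  have "\<exists>I\<in>R. (\<forall>J\<in>R. norming_coeff p q R w J \<le> norming_coeff p q R w I) \<and>
      (B \<subseteq> R \<and> R \<inter> A \<noteq> {} \<longrightarrow> I \<in> A)" if R: "R \<subseteq> T" "R \<noteq> {}" for R
  proof (cases "B \<subseteq> R \<and> R \<inter> A \<noteq> {}")
    case True
    then obtain I where I: "I \<in> R" "I \<in> A" by auto
    have "norming_coeff p q R w J \<le> norming_coeff p q R w I" if "J \<in> R" for J
      using coeff_A[OF R(1) I] coeff_A[OF R(1) that] coeff_B[OF R(1), of J] True that R(1)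
      by (cases "J \<in> A") (auto simp: T_def)
    then show ?thesis using I by blast
  next
    case False
    have "finite R" using R T finite_subset by auto
    then have "Max (norming_coeff p q R w ` R) \<in> norming_coeff p q R w ` R"
      using R by (intro Max_in) auto
    then obtain I where I: "I \<in> R" "norming_coeff p q R w I = Max (norming_coeff p q R w ` R)"
      by (metis imageE)
    then have "norming_coeff p q R w J \<le> norming_coeff p q R w I" if "J \<in> R" for J
      using \<open>finite R\<close> that by simp
    with False I(1) show ?thesis by blast
  qed
  then obtain pick where pick: "\<And>R. R \<subseteq> T \<Longrightarrow> R \<noteq> {} \<Longrightarrow> pick R \<in> R"
      "\<And>R J. R \<subseteq> T \<Longrightarrow> J \<in> R \<Longrightarrow> norming_coeff p q R w J \<le> norming_coeff p q R w (pick R)"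
      "\<And>R. R \<subseteq> T \<Longrightarrow> B \<subseteq> R \<Longrightarrow> R \<inter> A \<noteq> {} \<Longrightarrow> pick R \<in> A"
    by (metis empty_iff inf_bot_left)
  define rest where "rest = (\<lambda>n. ((\<lambda>R. R - {pick R}) ^^ n) T)"
  have rest: "rest 0 = T" "rest (Suc n) = rest n - {pick (rest n)}" for n
    by (simp_all add: rest_def)
  \<comment> \<open>Each of the first \<open>M\<close> steps removes exactly one strip and no
    block.\<close>
  have "B \<subseteq> rest n \<and> rest n \<subseteq> T \<and> card (rest n \<inter> A) = M - n" if "n \<le> M" for n
    using that
  proof (induction n)
    case 0
    have "T \<inter> A = A" by (auto simp: T_def)
    then show ?case
      by (simp add: rest T_def A_def card_strips)
  next
    case (Suc n)
    then have IH: "B \<subseteq> rest n" "rest n \<subseteq> T" "card (rest n \<inter> A) = M - n" by auto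
    then have "rest n \<inter> A \<noteq> {}"
      using Suc.prems by auto
    then have P: "pick (rest n) \<in> A" "pick (rest n) \<in> rest n"
      using IH pick by auto
    have "rest (Suc n) \<inter> A = (rest n \<inter> A) - {pick (rest n)}"
      by (auto simp: rest)
    then have "card (rest (Suc n) \<inter> A) = M - Suc n"
      using P IH(3) A by simp
    then show ?case
      using IH P AB_disj by (auto simp: rest)
  qed
  from this[of M] have "rest M = B"
    using A(1) by (auto simp: T_def)
  then have "T - rest M = A"
    using AB_disj by (auto simp: T_def)
  then have "f_norm p q (restr T w - restr A w :: _ \<Rightarrow> 'k)
      \<le> C * sigma_N (f_norm p q) canonical_basis N (restr T w :: _ \<Rightarrow> 'k)"
    using hyp[OF restr_in_f_space[OF T] wcga_run_truncations[OF T w pick(1,2) \<tau> rest]] by simp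
  also have "restr T w - restr A w = (restr B w :: _ \<Rightarrow> 'k)"
    using AB_disj by (subst restr_minus_restr) (auto simp: T_def intro!: arg_cong2[where f = restr])
  also have "restr B w = (restr B (\<lambda>_. 1) :: _ \<Rightarrow> 'k)"
    using AB_disj by (auto simp: restr_def w_def fun_eq_iff)
  \<comment> \<open>The competitor is the block part, which has at most \<open>N\<close>
    terms.\<close>
  also have "sigma_N (f_norm p q) canonical_basis N (restr T w :: _ \<Rightarrow> 'k)
      \<le> f_norm p q (restr T w - restr B w :: _ \<Rightarrow> 'k)"
    unfolding sigma_N_def dist_to_def
  proof (rule cINF_lower)
    show "bdd_below ((\<lambda>a. f_norm p q (restr T w - a :: _ \<Rightarrow> 'k)) ` Sigma_N canonical_basis N)"
      by (rule bdd_belowI2[of _ 0]) (rule f_norm_nonneg)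
    have "card (unit_seq ` B :: (_ \<Rightarrow> 'k) set) \<le> N"
      using card_image_le[OF B(1), of "unit_seq :: _ \<Rightarrow> _ \<Rightarrow> 'k"] card_blocks_le[of e r] N
      by (simp add: B_def)
    then show "(restr B w :: _ \<Rightarrow> 'k) \<in> Sigma_N canonical_basis N"
      unfolding Sigma_N_def canonical_basis_def
      using B restr_in_span[OF B(1), of w] by (intro UN_I[of "unit_seq ` B"]) auto
  qed
  also have "restr T w - restr B w = (restr A w :: _ \<Rightarrow> 'k)"
    using AB_disj by (subst restr_minus_restr) (auto simp: T_def intro!: arg_cong2[where f = restr])
  also have "restr A w = (restr A (\<lambda>_. a) :: _ \<Rightarrow> 'k)"
    by (auto simp: restr_def w_def fun_eq_iff)
  finally have "f_norm p q (restr B (\<lambda>_. 1) :: _ \<Rightarrow> 'k) \<le> C * f_norm p q (restr A (\<lambda>_. a) :: _ \<Rightarrow> 'k)"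
    using C by simp
  then have upper: "f_norm p q (restr B (\<lambda>_. 1) :: _ \<Rightarrow> 'k) powr p
      \<le> (C * f_norm p q (restr A (\<lambda>_. a) :: _ \<Rightarrow> 'k)) powr p"
    by (intro powr_mono2) (auto simp: f_norm_nonneg)
  have card: "f_norm p q (restr A (\<lambda>_. a) :: _ \<Rightarrow> 'k) powr p = real M * a powr p"
    using f_norm_restr_disjoint[where ?'k = 'k, OF A, of a] a disjoint_strips[of e M] card_strips[of e M]
    by (simp add: A_def)
  \<comment> \<open>The volume 1/2 of the half cube cancels the extra factor 2 in the inverse block
    volume.\<close>
  have "2 ^ (CARD('d) * r) * K powr (p / q) \<le> f_norm p q (restr B (\<lambda>_. 1) :: _ \<Rightarrow> 'k) powr p"
  proof -
    have "K powr (p / q) / (1 / 2 ^ Suc (CARD('d) * r)) * measure lborel (lower_half e)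
        \<le> f_norm p q (restr B (\<lambda>_. 1) :: _ \<Rightarrow> 'k) powr p"
      using blocks_overlap[of _ e r] K
      by (intro f_norm_restr_overlap B lower_half_dyadic)
         (auto simp: B_def measure_blocks K_def simp del: power_Suc of_nat_power)
    then show ?thesis
      by (simp add: measure_lower_half mult_ac)
  qed
  then have "2 ^ (CARD('d) * r) * K powr (p / q) \<le> C powr p * (real M * a powr p)"
    using upper C by (simp add: powr_mult f_norm_nonneg card)
  \<comment> \<open>Multiplication by \<open>K powr (p * \<theta>)\<close> removes
    \<open>a powr p\<close> from the right side.\<close>
  then have "2 ^ (CARD('d) * r) * K powr (p / q) * K powr (p * \<theta>)
      \<le> C powr p * (real M * a powr p) * K powr (p * \<theta>)"
    by (rule mult_right_mono) simp
  also have "C powr p * (real M * a powr p) * K powr (p * \<theta>) = C powr p * real M * (a powr p * K powr (p * \<theta>))"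
    by simp
  also have "a powr p * K powr (p * \<theta>) = 1"
    using K by (simp add: a_def powr_powr mult_ac flip: powr_add)
  also have "2 ^ (CARD('d) * r) * K powr (p / q) * K powr (p * \<theta>)
      = 2 ^ (CARD('d) * r) * K powr (p / q + p * \<theta>)"
    by (simp add: powr_add)
  also have "p / q + p * \<theta> = 1 + \<theta>"
  proof -
    have "(p - 1) * \<theta> = 1 - p / q"
      using p by (simp add: \<theta>_def)
    then show ?thesis by (simp add: algebra_simps)
  qed
  finally show ?thesis
    by (simp add: K_def \<theta>_def)
qed

end

text \<open>For given N the scale r is taken just before
  \<open>Suc r ^ (d - 1) * 2 ^ (d * r)\<close> first exceeds N. Passing to r + 1 changes this number
  by a bounded factor only, so it is comparable to N, and r + 1 controls log N.\<close>

lemma block_count_scale: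
  fixes N d :: nat
  assumes "N \<ge> 1" "d \<ge> 1"
  obtains r where "Suc r ^ (d - 1) * 2 ^ (d * r) \<le> N"
    and "real N \<le> 4 ^ d * (2 ^ (d * r) * real (Suc r ^ (d - 1)))"
    and "1 + ln (real N) \<le> 3 * real d * real (Suc r)"
proof -
  define c where "c = (\<lambda>r. Suc r ^ (d - 1) * 2 ^ (d * r) :: nat)"
  have "N < c N"
  proof -
    have "N < 2 ^ N" by (rule less_exp)
    also have "(2::nat) ^ N \<le> 2 ^ (d * N)"
      using assms by (intro power_increasing) auto
    also have "\<dots> \<le> c N" by (simp add: c_def)
    finally show ?thesis .
  qed
  \<comment> \<open>Such a scale exists as \<open>N < c N\<close>, and it is positive as
    \<open>c 0\<close> is 1.\<close>
  define s where "s = (LEAST s. N < c s)"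
  have s: "N < c s"
    unfolding s_def using \<open>N < c N\<close> by (rule LeastI)
  have "c 0 \<le> N" using assms by (simp add: c_def)
  with s obtain r where r: "s = Suc r"
    by (cases s) auto
  have "\<not> N < c r"
    using not_less_Least[of r "\<lambda>s. N < c s"] r by (simp add: s_def)
  then have low: "c r \<le> N" by simp
  \<comment> \<open>From r + 2 \<le> 2 (r + 1), the polynomial factor at most grows by 2^d; the
    exponential factor grows by exactly 2^d.\<close>
  have "Suc (Suc r) ^ (d - 1) \<le> (2 * Suc r) ^ (d - 1)"
    by (intro power_mono) auto
  also have "\<dots> = 2 ^ (d - 1) * Suc r ^ (d - 1)"
    by (rule power_mult_distrib)
  also have "\<dots> \<le> 2 ^ d * Suc r ^ (d - 1)"
    by (intro mult_right_mono power_increasing) auto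
  finally have "c s \<le> 2 ^ d * Suc r ^ (d - 1) * 2 ^ (d * Suc r)"
    unfolding c_def r by (rule mult_right_mono) simp
  also have "\<dots> = (2 * 2) ^ d * (2 ^ (d * r) * Suc r ^ (d - 1))"
    unfolding power_mult_distrib by (simp add: power_add del: power_Suc)
  finally have "N \<le> 4 ^ d * (2 ^ (d * r) * Suc r ^ (d - 1))"
    using s by simp
  then have "real N \<le> real (4 ^ d * (2 ^ (d * r) * Suc r ^ (d - 1)))"
    by (simp only: of_nat_le_iff)
  then have up: "real N \<le> 4 ^ d * (2 ^ (d * r) * real (Suc r ^ (d - 1)))"
    by simp
  have "real N \<le> real (c s)" using s by simp
  \<comment> \<open>Under the logarithm the polynomial factor may be replaced by an exponential
    one.\<close>
  also have "c s \<le> (2 ^ s) ^ d * 2 ^ (d * s)"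
  proof -
    have "Suc s ^ (d - 1) \<le> Suc s ^ d"
      by (intro power_increasing) auto
    also have "\<dots> \<le> (2 ^ s) ^ d"
      by (intro power_mono) (auto simp: Suc_le_eq)
    finally show ?thesis
      unfolding c_def by (rule mult_right_mono) simp
  qed
  also have "real ((2 ^ s) ^ d * 2 ^ (d * s)) = 2 ^ (2 * d * s)"
    by (simp add: power_add[symmetric] power_mult[symmetric] mult_ac mult_2)
  finally have "ln (real N) \<le> ln (2 ^ (2 * d * s))"
    using assms by simp
  also have "\<dots> = real (2 * d * s) * ln 2"
    by (simp add: ln_realpow)
  also have "\<dots> \<le> real (2 * d * s) * 1"
    using ln_2_less_1 by (intro mult_left_mono) auto
  finally have "1 + ln (real N) \<le> 1 + 2 * real d * real (Suc r)"
    by (simp add: r algebra_simps)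
  also have "1 \<le> real d * real (Suc r)"
    using assms mult_mono[of 1 "real d" 1 "real (Suc r)"] by simp
  finally have "1 + ln (real N) \<le> 3 * real d * real (Suc r)"
    by simp
  with low up show ?thesis
    by (intro that) (auto simp: c_def)
qed

theorem theorem5p19:
  fixes p q \<tau> C :: real and \<psi> :: "nat \<Rightarrow> nat"
  assumes "1 < p" and "p \<le> q"
    and "0 < \<tau>" and "\<tau> \<le> 1"
    and "C > 0"
    and "\<forall>N\<ge>1. \<forall>x \<in> (f_space p q :: ((real ^ 'd) set \<Rightarrow> 'k::real_normed_field) set). \<forall>\<phi> G.
           wcga_run (f_space p q) (f_norm p q) canonical_basis \<tau> x \<phi> G \<longrightarrow>
           f_norm p q (x - G (\<psi> N)) \<le> C * sigma_N (f_norm p q) canonical_basis N x"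
  shows "\<exists>c'>0. \<forall>N\<ge>1.
           real (\<psi> N) \<ge>
             c' * (1 + ln (real N)) powr (p / (p - 1) * (real CARD('d) - 1) * (1 / p - 1 / q)) * real N"
proof -
  interpret mixed_exponents p q
    using assms by unfold_locales
  define d where "d = CARD('d)"
  have d: "d \<ge> 1" by (simp add: d_def Suc_le_eq)
  define \<theta> where "\<theta> = (1 - p / q) / (p - 1)"
  define \<eta> where "\<eta> = (real d - 1) * \<theta>"
  have \<theta>: "\<theta> \<ge> 0"
    using p p_le_q q by (simp add: \<theta>_def)
  then have \<eta>: "\<eta> \<ge> 0" using d by (simp add: \<eta>_def)
  \<comment> \<open>The identity p' (1/p - 1/q) = (1 - p/q) / (p - 1) matches the claimed exponent
    with the one produced by balancing.\<close>
  have exponent: "p / (p - 1) * (real CARD('d) - 1) * (1 / p - 1 / q) = \<eta>"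
    using p q unfolding \<eta>_def \<theta>_def d_def[symmetric] by (simp add: field_simps)
  \<comment> \<open>The three factors come from the norm comparison, from N against the block count,
    and from log N against r + 1.\<close>
  define c' where "c' = 1 / (C powr p * 4 ^ d * (3 * real d) powr \<eta>)"
  have den: "C powr p * 4 ^ d * (3 * real d) powr \<eta> > 0"
    using assms d by simp
  show ?thesis
    unfolding exponent
  proof (intro exI[of _ c'] conjI allI impI)
    show "c' > 0" using den by (simp add: c'_def)
    fix N :: nat assume N: "N \<ge> 1"
    obtain r where r: "Suc r ^ (d - 1) * 2 ^ (d * r) \<le> N"
      "real N \<le> 4 ^ d * (2 ^ (d * r) * real (Suc r ^ (d - 1)))"
      "1 + ln (real N) \<le> 3 * real d * real (Suc r)"
      using block_count_scale[OF N d] by blast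
    define K where "K = real (Suc r ^ (d - 1))"
    have K: "K > 0" by (simp add: K_def)
    have "K powr \<theta> = real (Suc r) powr \<eta>"
      using d by (simp add: K_def \<eta>_def powr_powr of_nat_diff flip: powr_realpow)
    have "2 ^ (d * r) * K powr (1 + \<theta>) \<le> C powr p * real (\<psi> N)"
      unfolding K_def \<theta>_def d_def
      using assms N r(1) by (intro wcga_lower_bound[where \<tau> = \<tau> and N = N and ?'k = 'k]) (auto simp: d_def)
    have "(1 + ln (real N)) powr \<eta> \<le> (3 * real d * real (Suc r)) powr \<eta>"
      using N r(3) \<eta> by (intro powr_mono2) auto
    also have "\<dots> = (3 * real d) powr \<eta> * K powr \<theta>"
      by (simp add: \<open>K powr \<theta> = real (Suc r) powr \<eta>\<close> powr_mult)
    \<comment> \<open>Of \<open>K powr (1 + \<theta>)\<close>, one factor \<open>K\<close> accounts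
      for N and \<open>K powr \<theta>\<close> for the power of the logarithm.\<close>
    finally have "(1 + ln (real N)) powr \<eta> * real N
        \<le> ((3 * real d) powr \<eta> * K powr \<theta>) * (4 ^ d * (2 ^ (d * r) * K))"
      using r(2) unfolding K_def by (intro mult_mono) auto
    also have "\<dots> = (3 * real d) powr \<eta> * 4 ^ d * (2 ^ (d * r) * K powr (1 + \<theta>))"
      using K by (simp add: powr_add)
    also have "\<dots> \<le> (3 * real d) powr \<eta> * 4 ^ d * (C powr p * real (\<psi> N))"
      using \<open>2 ^ (d * r) * K powr (1 + \<theta>) \<le> C powr p * real (\<psi> N)\<close> by (intro mult_left_mono) auto
    finally show "real (\<psi> N) \<ge> c' * (1 + ln (real N)) powr \<eta> * real N"
      using den by (simp add: c'_def pos_divide_le_eq mult_ac)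
  qed
qed

end
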